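(* Let $h>0$, let $g$ satisfy (M) and $k_0$ satisfy (K$_0$) (see context), let $c_*^{\pm}$ and $\lambda_*^{\pm}$ be the critical speeds and tangency points defined in the context, and let $u$ be the solution of $$u_t(t,x)=u_{xx}(t,x)-u(t,x)+\int_{\mathbb{R}}k_0(y)\,g(u(t-h,x-y))\,dy,\quad t>0,\ x\in\mathbb{R},$$ with nonnegative initial data $u(s,x)=u_0(s,x)$, $(s,x)\in[-h,0]\times\mathbb{R}$, $u_0\in C([-h,0],L^1(\mathbb{R}))$. Let $\beta>0$, and let $m_\beta^{\pm}(t;u_0)$ be defined as in the context. Then: (i) If the initial datum satisfies $e^{-\lambda_*^+(\cdot)}u_0(\cdot)\in L^1(\mathbb{R})\cap L^\infty(\mathbb{R})$ (as a function of $x$, uniformly in $s\in[-h,0]$), then there exists $B\in\mathbb{R}$ such that $$m_\beta^-(t;u_0)\ \ge\ \frac{1}{2\lambda_*^+}\log t-c_*^+t+B\qquad\text{for all }t>0.$$ (ii) If the initial datum satisfies $e^{-\lambda_*^-(\cdot)}u_0(\cdot)\in L^1(\mathbb{R})\cap L^\infty(\mathbb{R})$ (as a function of $x$, uniformly in $s\in[-h,0]$), then there exists $B\in\mathbb{R}$ such that $$m_\beta^+(t;u_0)\ \le\ \frac{1}{2\lambda_*^-}\log t-c_*^-t+B\qquad\text{for all }t>0.$$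
   Context: (M): $g:\mathbb{R}_+\to\mathbb{R}_+$ is a (Lipschitz) function such that $g(x)=x$ has exactly two solutions, $0$ and $\kappa>0$, and $g(u)\le g'(0)u$ for all $u\ge0$. Moreover $g$ is $C^1$-smooth in some $\delta_0$-neighborhood of the equilibria $0,\kappa$, where $g'(0)>1>g'(\kappa)$, and there are $C>0$, $\theta\in(0,1]$ such that $|g'(u)-g'(0)|+|g'(\kappa)-g'(\kappa-u)|\le Cu^\theta$ for $u\in(0,\delta_0]$. (K$_0$): $k_0\ge0$, $\int_{\mathbb{R}}k_0(z)\,dz=1$, and, for given $a<0<b$, $\int_{\mathbb{R}}k_0(z)e^{\lambda z}dz<\infty$ for all $\lambda\in(a,b)$. Critical speeds: $c_*^-<c_*^+$ are the numbers such that the set of admissible speeds of semi-wavefronts (nonnegative bounded solutions of the form $u(t,x)=\phi_c(x+ct)$ with $\phi_c(-\infty)=0$ or $\phi_c(+\infty)=0$) is $(-\infty,c_*^-]\cup[c_*^+,+\infty)$. There are values $\lambda_*^-<0<\lambda_*^+$ for which, respectively, the curves $$f_1^{\pm}(z)=-z^2+c_*^{\pm}z+1,\qquad f_2^{\pm}(z)=g'(0)e^{-zc_*^{\pm}h}\int_{\mathbb{R}}k_0(y)e^{-zy}dy$$ are tangent at $z=\lambda_*^{\pm}$, i.e. have equal values and equal derivatives there. Level sets: for $\beta>0$ and $t>0$, if the level $\beta$ is attained by $u(t,\cdot)$ at some point, then $m_\beta^-(t;u_0)=\inf\{x\in\mathbb{R}:u(t,x)=\beta\}$ and $m_\beta^+(t;u_0)=\sup\{x\in\mathbb{R}:u(t,x)=\beta\}$;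 if the level $\beta$ is not attained by $u(t,\cdot)$, one sets $m_\beta^{\pm}(t;u_0)=0$.
   Formalization: At times t when the level β is not attained, (i) is claimed only if c_*^+ > 0 and (ii) only if c_*^- < 0: with m_β^± = 0 there, the printed bounds fail otherwise, e.g. for u_0 = 0 with c_*^+ ≤ 0 (resp. c_*^- ≥ 0). *)

theory Defs
  imports "HOL-Analysis.Analysis"
begin

section \<open>The birth function and the kernel\<close>

text \<open>The function \<open>g\<close> is only meaningful on the half-line of nonnegative reals, so
  its derivative \<open>g'\<close> is taken within that half-line (one-sided at 0). The Hoelder condition
  evaluates \<open>g'\<close> at distance exactly \<open>\<delta>\<close> from the equilibria and at \<open>\<kappa> - \<delta>\<close>, so closed
  neighbourhoods with \<open>\<delta> \<le> \<kappa>\<close> are used; as \<open>\<delta>\<close> may be shrunk, this is no restriction.\<close>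

definition monostable :: "(real \<Rightarrow> real) \<Rightarrow> (real \<Rightarrow> real) \<Rightarrow> real \<Rightarrow> bool" where
  "monostable g g' \<kappa> \<longleftrightarrow>
     (\<forall>x\<ge>0. 0 \<le> g x) \<and>
     (\<exists>L. L-lipschitz_on {0..} g) \<and>
     0 < \<kappa> \<and> {x. 0 \<le> x \<and> g x = x} = {0, \<kappa>} \<and>
     (\<forall>x\<ge>0. g x \<le> g' 0 * x) \<and>
     1 < g' 0 \<and> g' \<kappa> < 1 \<and>
     (\<exists>\<delta> C \<theta>. 0 < \<delta> \<and> \<delta> \<le> \<kappa> \<and> 0 < C \<and> 0 < \<theta> \<and> \<theta> \<le> 1 \<and>
        (\<forall>x \<in> {0..\<delta>} \<union> {\<kappa>-\<delta>..\<kappa>+\<delta>}. (g has_real_derivative g' x) (at x within {0..})) \<and>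
        continuous_on ({0..\<delta>} \<union> {\<kappa>-\<delta>..\<kappa>+\<delta>}) g' \<and>
        (\<forall>x\<in>{0<..\<delta>}. \<bar>g' x - g' 0\<bar> + \<bar>g' \<kappa> - g' (\<kappa> - x)\<bar> \<le> C * x powr \<theta>))"

definition admissible_kernel :: "(real \<Rightarrow> real) \<Rightarrow> real \<Rightarrow> real \<Rightarrow> bool" where
  "admissible_kernel k0 a b \<longleftrightarrow>
     a < 0 \<and> 0 < b \<and> (\<forall>z. 0 \<le> k0 z) \<and> has_bochner_integral lborel k0 1 \<and>
     (\<forall>\<mu>\<in>{a<..<b}. integrable lborel (\<lambda>z. k0 z * exp (\<mu> * z)))"

section \<open>Semi-wavefronts, critical speeds and tangency\<close>

definition nonlocal_birth :: "(real \<Rightarrow> real) \<Rightarrow> (real \<Rightarrow> real) \<Rightarrow> (real \<Rightarrow> real) \<Rightarrow> real \<Rightarrow> real" where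
  "nonlocal_birth g k0 v x = (LINT y|lborel. k0 y * g (v (x - y)))"

definition entire_classical_solution ::
    "real \<Rightarrow> (real \<Rightarrow> real) \<Rightarrow> (real \<Rightarrow> real) \<Rightarrow> (real \<Rightarrow> real \<Rightarrow> real) \<Rightarrow> bool" where
  "entire_classical_solution h g k0 u \<longleftrightarrow>
     (\<exists>ut ux uxx. \<forall>t x.
        ((\<lambda>s. u s x) has_real_derivative ut t x) (at t) \<and>
        (u t has_real_derivative ux t x) (at x) \<and>
        (ux t has_real_derivative uxx t x) (at x) \<and>
        ut t x = uxx t x - u t x + nonlocal_birth g k0 (u (t - h)) x)"

text \<open>The zero profile has to be excluded: it would make every speed admissible.\<close>

definition semi_wavefront ::
    "real \<Rightarrow> (real \<Rightarrow> real) \<Rightarrow> (real \<Rightarrow> real) \<Rightarrow> real \<Rightarrow> (real \<Rightarrow> real) \<Rightarrow> bool" where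
  "semi_wavefront h g k0 c \<phi> \<longleftrightarrow>
     (\<forall>s. 0 \<le> \<phi> s) \<and> (\<exists>s. \<phi> s \<noteq> 0) \<and> bounded (range \<phi>) \<and>
     ((\<phi> \<longlongrightarrow> 0) at_bot \<or> (\<phi> \<longlongrightarrow> 0) at_top) \<and>
     entire_classical_solution h g k0 (\<lambda>t x. \<phi> (x + c * t))"

definition critical_speeds ::
    "real \<Rightarrow> (real \<Rightarrow> real) \<Rightarrow> (real \<Rightarrow> real) \<Rightarrow> real \<Rightarrow> real \<Rightarrow> bool" where
  "critical_speeds h g k0 cm cp \<longleftrightarrow>
     cm < cp \<and> {c. \<exists>\<phi>. semi_wavefront h g k0 c \<phi>} = {..cm} \<union> {cp..}"

definition f1 :: "real \<Rightarrow> real \<Rightarrow> real" where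
  "f1 c z = - z\<^sup>2 + c * z + 1"

text \<open>Here \<open>\<gamma>\<close> is the value of \<open>g'\<close> at 0. Under \<open>admissible_kernel k0 a b\<close> the integral is known to
  converge for \<open>- b < z < - a\<close> (note the sign in the exponent).\<close>

definition f2 :: "real \<Rightarrow> real \<Rightarrow> (real \<Rightarrow> real) \<Rightarrow> real \<Rightarrow> real \<Rightarrow> real" where
  "f2 \<gamma> h k0 c z = \<gamma> * exp (- z * c * h) * (LINT y|lborel. k0 y * exp (- z * y))"

definition tangent_at :: "(real \<Rightarrow> real) \<Rightarrow> (real \<Rightarrow> real) \<Rightarrow> real \<Rightarrow> bool" where
  "tangent_at F G z \<longleftrightarrow>
     F z = G z \<and> (\<exists>D. (F has_real_derivative D) (at z) \<and> (G has_real_derivative D) (at z))"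

section \<open>The initial value problem\<close>

text \<open>Membership in \<open>C(S, L\<^sup>1(\<real>))\<close>; every \<open>f s\<close> is a representative of its class.\<close>

definition L1_continuous_on :: "real set \<Rightarrow> (real \<Rightarrow> real \<Rightarrow> real) \<Rightarrow> bool" where
  "L1_continuous_on S f \<longleftrightarrow>
     (\<forall>s\<in>S. integrable lborel (f s) \<and>
        ((\<lambda>r. LINT x|lborel. \<bar>f r x - f s x\<bar>) \<longlongrightarrow> 0) (at s within S))"

text \<open>For initial data that are merely in \<open>C([-h,0], L\<^sup>1(\<real>))\<close> (and a kernel that is merely
  integrable) the equation need not have a solution for which \<open>u\<^sub>t\<close> and \<open>u\<^sub>x\<^sub>x\<close> exist at every point
  on \<open>0 < t \<le> h\<close>. It is therefore required in the weak sense: tested against compactly supported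
  \<open>C\<^sup>2\<close> functions \<open>\<phi>\<close> of \<open>x\<close>, for every \<open>t > 0\<close>. Mild solutions, and classical solutions that are
  continuous into \<open>L\<^sup>1\<close>, are weak solutions. For \<open>t > 0\<close> the continuous representative of \<open>u t\<close> is
  the one meant, which gives level sets their meaning. Values are nonnegative because \<open>g\<close> is
  defined on the nonnegative half-line only.\<close>

definition solves_ivp ::
    "real \<Rightarrow> (real \<Rightarrow> real) \<Rightarrow> (real \<Rightarrow> real) \<Rightarrow> (real \<Rightarrow> real \<Rightarrow> real) \<Rightarrow> (real \<Rightarrow> real \<Rightarrow> real) \<Rightarrow> bool" where
  "solves_ivp h g k0 u0 u \<longleftrightarrow>
     (\<forall>s\<in>{-h..0}. \<forall>x. u s x = u0 s x) \<and>
     L1_continuous_on {-h..} u \<and>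
     (\<forall>t\<ge>-h. \<forall>x. 0 \<le> u t x) \<and>
     (\<forall>t>0. continuous_on UNIV (u t)) \<and>
     (\<forall>\<phi> \<phi>' \<phi>''.
        (\<forall>x. (\<phi> has_real_derivative \<phi>' x) (at x)) \<and>
        (\<forall>x. (\<phi>' has_real_derivative \<phi>'' x) (at x)) \<and>
        continuous_on UNIV \<phi>'' \<and> (\<exists>R. \<forall>x. R < \<bar>x\<bar> \<longrightarrow> \<phi> x = 0) \<longrightarrow>
        (\<forall>t>0. ((\<lambda>s. LINT x|lborel. u s x * \<phi> x) has_real_derivative
           (LINT x|lborel. u t x * \<phi>'' x) - (LINT x|lborel. u t x * \<phi> x)
             + (LINT x|lborel. nonlocal_birth g k0 (u (t - h)) x * \<phi> x)) (at t)))"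

text \<open>The function \<open>x \<mapsto> exp (- \<mu> x) u\<^sub>0(s,x)\<close> is in \<open>L\<^sup>1 \<inter> L\<^sup>\<infinity>\<close> with bounds independent of \<open>s\<close>.\<close>

definition weighted_L1_Linf :: "real \<Rightarrow> real \<Rightarrow> (real \<Rightarrow> real \<Rightarrow> real) \<Rightarrow> bool" where
  "weighted_L1_Linf \<mu> h u0 \<longleftrightarrow>
     (\<exists>K. \<forall>s\<in>{-h..0}.
        integrable lborel (\<lambda>x. exp (- \<mu> * x) * u0 s x) \<and>
        (LINT x|lborel. \<bar>exp (- \<mu> * x) * u0 s x\<bar>) \<le> K \<and>
        (AE x in lborel. \<bar>exp (- \<mu> * x) * u0 s x\<bar> \<le> K))"

section \<open>Level sets\<close>

text \<open>Extended reals are used because the infimum (supremum) of a level set can be infinite; the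
  real-valued infimum of a set unbounded below would be a meaningless value.\<close>

definition m_minus :: "(real \<Rightarrow> real \<Rightarrow> real) \<Rightarrow> real \<Rightarrow> real \<Rightarrow> ereal" where
  "m_minus u \<beta> t = (if \<exists>x. u t x = \<beta> then INF x\<in>{x. u t x = \<beta>}. ereal x else 0)"

definition m_plus :: "(real \<Rightarrow> real \<Rightarrow> real) \<Rightarrow> real \<Rightarrow> real \<Rightarrow> ereal" where
  "m_plus u \<beta> t = (if \<exists>x. u t x = \<beta> then SUP x\<in>{x. u t x = \<beta>}. ereal x else 0)"

end

theory Submission
  imports Defs "HOL-Probability.Distributions"
begin

text \<open>Both halves follow from one pointwise estimate, valid for either sign of \<open>l\<close>: if \<open>f1 c\<close> and \<open>f2\<close>
take the same value \<open>p\<close> at \<open>l\<close> and \<open>exp (- l x) u\<^sub>0\<close> is bounded in \<open>L\<^sup>1 \<inter> L\<^sup>\<infinity>\<close>, then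
\<open>u t x \<le> A / sqrt t * exp (l * (x + c * t))\<close> (lemma \<open>weighted_decay\<close>). At a point where \<open>u\<close> equals
\<open>\<beta>\<close>, taking logarithms and dividing by \<open>l\<close> bounds \<open>x\<close> from below if \<open>l > 0\<close> and from above if
\<open>l < 0\<close>.

The reason for the estimate is that \<open>g z \<le> g' 0 * z\<close>, so \<open>w(t,z) = exp (- l z) u(t, z - c t)\<close> is
dominated by the linear equation
\<open>w\<^sub>t = w\<^sub>z\<^sub>z + (2 l - c) w\<^sub>z - p w + p (\<nu> * w(t - h))\<close>. The coincidence \<open>f1 = f2 = p\<close> says exactly
that \<open>\<nu>\<close> is a probability measure and that the constants solve this equation. Neither growth nor
decay remains except what diffusion causes, and diffusion spreads a finite mass with rate
\<open>1 / sqrt t\<close>, slowed down by a constant factor because a particle does not diffuse during a delay.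

The proof measures this without solving the equation. The function \<open>u\<close> is smoothed by an additional
heat flow of duration \<open>s\<close>: \<open>heat_mean (u t) s y\<close> is the pairing of \<open>u t\<close> with the heat kernel centred
at \<open>y\<close>. On a line \<open>s + t = const\<close> the Laplacian in the equation cancels against the derivative of the
kernel in \<open>s\<close>, so only the damping \<open>- u\<close> and the delayed source remain, and the source is controlled
by heat means at time \<open>t - h\<close>. The barrier
\<open>C / sqrt (s + \<alpha> t + 2 \<alpha> h) * exp (l (y + c t) + l\<^sup>2 s)\<close> is a supersolution of the resulting delay
inequality as soon as \<open>\<alpha>\<close> is small (\<open>inverse_sqrt_delay_le\<close>, \<open>barrier_along_characteristic\<close>).
At times in \<open>[-h, 0]\<close> it dominates because of both norms of the datum: the \<open>L\<^sup>\<infinity>\<close> bound serves small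
\<open>s\<close>, the \<open>L\<^sup>1\<close> bound large \<open>s\<close> (\<open>initial_heat_mean_le_barrier\<close>). Induction over time steps of length
\<open>h\<close> carries the comparison to all times (\<open>heat_mean_le_barrier\<close>), and \<open>s \<rightarrow> 0\<close> recovers \<open>u t y\<close>
by Fatou's lemma and the continuity of \<open>u t\<close> (\<open>le_lim_of_heat_mean_le\<close>).

Heat kernels are not compactly supported, hence not admissible in the weak formulation. They are
multiplied by a cutoff of width \<open>R\<close>, which costs an error of order \<open>1 / R\<close>
(\<open>truncated_heat_mean_le\<close>).\<close>

section \<open>The heat kernel\<close>

definition heat_kernel :: "real \<Rightarrow> real \<Rightarrow> real" where
  "heat_kernel s x = exp (- (x\<^sup>2) / (4 * s)) / sqrt (4 * pi * s)"

definition heat_kernel_x :: "real \<Rightarrow> real \<Rightarrow> real" where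
  "heat_kernel_x s x = - (x / (2 * s)) * heat_kernel s x"

definition heat_kernel_xx :: "real \<Rightarrow> real \<Rightarrow> real" where
  "heat_kernel_xx s x = (x\<^sup>2 / (4 * s\<^sup>2) - 1 / (2 * s)) * heat_kernel s x"

lemma heat_kernel_nonneg: "0 < s \<Longrightarrow> 0 \<le> heat_kernel s x"
  by (simp add: heat_kernel_def)

lemma heat_kernel_DERIV_x:
  assumes "0 < s"
  shows "(heat_kernel s has_real_derivative heat_kernel_x s x) (at x)"
proof -
  have "((\<lambda>x. - (x\<^sup>2) / (4 * s)) has_real_derivative - (2 * x) / (4 * s)) (at x)"
    using assms by (auto intro!: derivative_eq_intros)
  from DERIV_cdivide[OF DERIV_fun_exp[OF this], of "sqrt (4 * pi * s)"] show ?thesis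
    by (simp add: heat_kernel_def[abs_def] heat_kernel_x_def mult_ac)
qed

lemma heat_kernel_x_DERIV_x:
  assumes "0 < s"
  shows "(heat_kernel_x s has_real_derivative heat_kernel_xx s x) (at x)"
proof -
  have "((\<lambda>x. - (x / (2 * s))) has_real_derivative - (1 / (2 * s))) (at x)"
    using assms by (auto intro!: derivative_eq_intros)
  from DERIV_mult[OF this heat_kernel_DERIV_x[OF assms]] show ?thesis
    by (simp add: heat_kernel_x_def[abs_def] heat_kernel_xx_def power2_eq_square algebra_simps)
qed

text \<open>The heat equation: the derivative in \<open>s\<close> is again \<open>heat_kernel_xx\<close>.\<close>
lemma heat_kernel_DERIV_s:
  assumes "0 < s"
  shows "((\<lambda>s. heat_kernel s x) has_real_derivative heat_kernel_xx s x) (at s)"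
proof -
  have sq: "sqrt (4 * pi * s) * sqrt (4 * pi * s) = 4 * pi * s"
    using assms by simp
  have pos: "0 < sqrt (4 * pi * s)" using assms by simp
  have 1: "((\<lambda>s. exp (- (x\<^sup>2) / (4 * s))) has_real_derivative
          exp (- (x\<^sup>2) / (4 * s)) * (x\<^sup>2 / (4 * s\<^sup>2))) (at s)"
  proof -
    have "((\<lambda>s. - (x\<^sup>2) / (4 * s)) has_real_derivative x\<^sup>2 / (4 * s\<^sup>2)) (at s)"
      using assms by (auto intro!: derivative_eq_intros simp: power2_eq_square)
    from DERIV_fun_exp[OF this] show ?thesis .
  qed
  have 2: "((\<lambda>s. sqrt (4 * pi * s)) has_real_derivative
          inverse (sqrt (4 * pi * s)) / 2 * (4 * pi)) (at s)"
  proof -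
    have "((\<lambda>s. 4 * pi * s) has_real_derivative 4 * pi) (at s)"
      using DERIV_cmult_Id[of "4 * pi" s] by simp
    from DERIV_chain2[OF DERIV_real_sqrt this] show ?thesis using assms by simp
  qed
  have 3: "((\<lambda>s. exp (- (x\<^sup>2) / (4 * s)) / sqrt (4 * pi * s)) has_real_derivative
     (exp (- (x\<^sup>2) / (4 * s)) * (x\<^sup>2 / (4 * s\<^sup>2)) * sqrt (4 * pi * s)
      - exp (- (x\<^sup>2) / (4 * s)) * (inverse (sqrt (4 * pi * s)) / 2 * (4 * pi)))
      / (sqrt (4 * pi * s) * sqrt (4 * pi * s))) (at s)"
    by (rule DERIV_divide[OF 1 2]) (use assms in simp)
  have alg: "(e * q * r - e * (inverse r / 2 * (4 * p))) / (r * r) = (q - 1 / (2 * s)) * (e / r)"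
    if "r \<noteq> 0" "r * r = 4 * p * s" "s \<noteq> 0" "p \<noteq> 0" for e q r p :: real
  proof -
    have "inverse r / 2 * (4 * p) = r * (1 / (2 * s))"
      using that by (simp add: field_simps)
    then show ?thesis using that by (simp add: field_simps)
  qed
  have "(exp (- (x\<^sup>2) / (4 * s)) * (x\<^sup>2 / (4 * s\<^sup>2)) * sqrt (4 * pi * s)
      - exp (- (x\<^sup>2) / (4 * s)) * (inverse (sqrt (4 * pi * s)) / 2 * (4 * pi)))
      / (sqrt (4 * pi * s) * sqrt (4 * pi * s)) = heat_kernel_xx s x"
    unfolding heat_kernel_xx_def heat_kernel_def
    by (rule alg) (use pos sq assms in auto)
  with 3 show ?thesis unfolding heat_kernel_def[abs_def] by simp
qed

text \<open>A common bound for the kernel and the derivatives used below, for all heat times \<open>s \<ge> m\<close>; only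
its finiteness matters.\<close>
definition heat_bound :: "real \<Rightarrow> real" where
  "heat_bound m = (1 + 1 / m) / sqrt (4 * pi * m)"

text \<open>With \<open>q = x\<^sup>2 / (4 s)\<close> everything reduces to \<open>(1 + q) exp (- q) \<le> 1\<close>, the factor \<open>x\<close> in the first
derivative being absorbed by \<open>\<bar>x\<bar> \<le> 1 + x\<^sup>2 / 4\<close>.\<close>
lemma heat_kernel_bounds:
  assumes "0 < m" "m \<le> s"
  shows "\<bar>heat_kernel s x\<bar> \<le> heat_bound m"
    and "\<bar>heat_kernel_x s x\<bar> \<le> heat_bound m"
    and "\<bar>heat_kernel_xx s x\<bar> \<le> heat_bound m"
proof -
  define q where "q = x\<^sup>2 / (4 * s)"
  define r where "r = sqrt (4 * pi * s)"
  define e where "e = exp (- q)"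
  have s: "0 < s" using assms by simp
  have q: "0 \<le> q" using s by (simp add: q_def)
  have e: "0 < e" by (simp add: e_def)
  have "(1 + q) * e \<le> exp q * e"
    using exp_ge_add_one_self[of q] e by (intro mult_right_mono) auto
  also have "\<dots> = 1" by (simp add: e_def flip: exp_add)
  finally have qe: "e + q * e \<le> 1" by (simp add: algebra_simps)
  have e1: "e \<le> 1" and qe1: "q * e \<le> 1"
    using qe e q by (auto intro: order_trans[OF _ qe])
  have G: "heat_kernel s x = e / r"
    by (simp add: heat_kernel_def e_def q_def r_def)
  have r: "0 < r" "0 < sqrt (4 * pi * m)" "sqrt (4 * pi * m) \<le> r"
    using assms s by (auto simp: r_def)
  have im: "1 / s \<le> 1 / m" "0 < 1 / s" using assms by (auto simp: field_simps)
  have step: "\<bar>c / r\<bar> \<le> heat_bound m" if "\<bar>c\<bar> \<le> 1 + 1 / s" for c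
  proof -
    have "\<bar>c / r\<bar> = \<bar>c\<bar> / r" using r(1) by (simp only: abs_divide abs_of_pos)
    also have "\<dots> \<le> (1 + 1 / m) / sqrt (4 * pi * m)"
      using r that im by (intro frac_le) auto
    finally show ?thesis by (simp add: heat_bound_def)
  qed
  show "\<bar>heat_kernel s x\<bar> \<le> heat_bound m"
    unfolding G using e e1 im by (intro step) linarith
  have "0 \<le> (\<bar>x\<bar> / 2 - 1)\<^sup>2" by simp
  also have "(\<bar>x\<bar> / 2 - 1)\<^sup>2 = 1 + q * s - \<bar>x\<bar>"
    using s by (simp add: q_def power2_eq_square field_simps)
  finally have x: "\<bar>x\<bar> \<le> 1 + q * s" by simp
  have "\<bar>x / (2 * s) * e\<bar> = \<bar>x\<bar> * (e / (2 * s))"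
    using s e by (simp add: abs_mult)
  also have "\<dots> \<le> (1 + q * s) * (e / (2 * s))"
    using x s e by (intro mult_right_mono) auto
  also have "\<dots> = (e * (1 / s)  + q * e) / 2"
    using s by (simp add: field_simps)
  also have "\<dots> \<le> 1 + 1 / s"
  proof -
    have "e * (1 / s) \<le> 1 * (1 / s)" using e1 im by (intro mult_right_mono) auto
    moreover have "(A + B) / 2 \<le> 1 + D" if "A \<le> 1 * D" "B \<le> 1" "0 < D" for A B D :: real
      using that by (simp add: field_simps)
    ultimately show ?thesis using qe1 im by blast
  qed
  finally have gx: "\<bar>x / (2 * s) * e\<bar> \<le> 1 + 1 / s" .
  have "heat_kernel_x s x = (- (x / (2 * s) * e)) / r"
    by (simp add: heat_kernel_x_def G)
  then show "\<bar>heat_kernel_x s x\<bar> \<le> heat_bound m"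
    using step[of "- (x / (2 * s) * e)"] gx by simp
  have gxx: "heat_kernel_xx s x = ((q * e - e / 2) * (1 / s)) / r"
    using s by (simp add: heat_kernel_xx_def G q_def field_simps power2_eq_square)
  have "\<bar>q * e - e / 2\<bar> \<le> 1" using e q qe mult_nonneg_nonneg[of q e] unfolding abs_le_iff by linarith
  then have "\<bar>(q * e - e / 2) * (1 / s)\<bar> \<le> 1 * (1 / s)"
    unfolding abs_mult using im by (intro mult_mono) auto
  then show "\<bar>heat_kernel_xx s x\<bar> \<le> heat_bound m"
    unfolding gxx using im by (intro step) linarith
qed

lemma heat_bound_nonneg: "0 < m \<Longrightarrow> 0 \<le> heat_bound m"
  by (simp add: heat_bound_def)

lemma heat_kernel_lipschitz_s:
  assumes "0 < m" "m \<le> r" "m \<le> s"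
  shows "\<bar>heat_kernel r x - heat_kernel s x\<bar> \<le> heat_bound m * \<bar>r - s\<bar>"
proof -
  have "norm (heat_kernel r x - heat_kernel s x) \<le> heat_bound m * norm (r - s)"
  proof (rule field_differentiable_bound[where S = "{m..}" and f' = "\<lambda>s. heat_kernel_xx s x"])
    show "((\<lambda>s. heat_kernel s x) has_field_derivative heat_kernel_xx z x) (at z within {m..})"
      if "z \<in> {m..}" for z
      using that assms by (intro has_field_derivative_at_within[OF heat_kernel_DERIV_s]) auto
    show "norm (heat_kernel_xx z x) \<le> heat_bound m" if "z \<in> {m..}" for z
      using that assms heat_kernel_bounds(3)[of m z x] by auto
  qed (use assms in auto)
  then show ?thesis by simp
qed

lemma heat_kernel_measurable [measurable]: "heat_kernel s \<in> borel_measurable borel"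
  unfolding heat_kernel_def[abs_def] by measurable

lemma nn_integral_heat_kernel:
  assumes "0 < s"
  shows "(\<integral>\<^sup>+x. ennreal (heat_kernel s (x - y)) \<partial>lborel) = 1"
proof -
  have "heat_kernel s (x - y) = normal_density y (sqrt (2 * s)) x" for x
    using assms by (simp add: heat_kernel_def normal_density_def)
  then show ?thesis
    using assms by (subst nn_integral_eq_integral) (auto simp: heat_kernel_nonneg)
qed

text \<open>Completing the square: an exponential weight turns a heat kernel into a translated heat kernel. The
factor \<open>exp (l\<^sup>2 s)\<close> is the growth of \<open>exp (l x)\<close> under the heat flow.\<close>
lemma heat_kernel_exp_shift:
  assumes "0 < s"
  shows "exp (l * x) * heat_kernel s (x - y) =
         exp (l * y + l\<^sup>2 * s) * heat_kernel s (x - (y + 2 * l * s))"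
proof -
  have "l * x + - ((x - y)\<^sup>2) / (4 * s) = l * y + l\<^sup>2 * s + - ((x - (y + 2 * l * s))\<^sup>2) / (4 * s)"
  proof -
    have "((x - y)\<^sup>2) / (4 * s) - ((x - (y + 2 * l * s))\<^sup>2) / (4 * s) = ((x - y) * (4 * l * s) - 4 * l\<^sup>2 * s\<^sup>2) / (4 * s)"
      by (simp add: power2_eq_square algebra_simps flip: diff_divide_distrib)
    also have "\<dots> = l * (x - y) - l\<^sup>2 * s"
      using assms by (simp add: diff_divide_distrib power2_eq_square)
    finally show ?thesis by (simp add: algebra_simps)
  qed
  then have "exp (l * x) * exp (- ((x - y)\<^sup>2) / (4 * s)) =
      exp (l * y + l\<^sup>2 * s) * exp (- ((x - (y + 2 * l * s))\<^sup>2) / (4 * s))"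
    by (simp only: exp_add[symmetric])
  then show ?thesis by (simp add: heat_kernel_def)
qed

section \<open>A compactly supported cutoff of class \<open>C\<^sup>2\<close>\<close>

lemma pos_part_power_DERIV:
  fixes s :: real
  assumes "2 \<le> k"
  shows "((\<lambda>s. max 0 s ^ k) has_real_derivative real k * max 0 s ^ (k - 1)) (at s)"
proof -
  consider "s < 0" | "s > 0" | "s = 0" by linarith
  then show ?thesis
  proof cases
    case 1
    have "((\<lambda>s::real. 0) has_real_derivative real k * max 0 s ^ (k - 1)) (at s)"
      using 1 assms by (simp add: power_0_left)
    then show ?thesis
      by (rule has_field_derivative_transform_within_open[where S = "{..<0}"])
         (use 1 assms in \<open>auto simp: power_0_left\<close>)
  next
    case 2
    have "((\<lambda>s::real. s ^ k) has_real_derivative real k * max 0 s ^ (k - 1)) (at s)"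
      using 2 by (auto intro!: derivative_eq_intros)
    then show ?thesis
      by (rule has_field_derivative_transform_within_open[where S = "{0<..}"])
         (use 2 in auto)
  next
    case 3
    obtain j where k: "k = Suc (Suc j)" using assms by (metis add_2_eq_Suc le_Suc_ex)
    have "((\<lambda>h::real. max 0 h ^ k / h) \<longlongrightarrow> 0) (at 0)"
    proof (rule Lim_null_comparison)
      have "norm (max 0 h ^ k / h) \<le> max 0 h ^ (Suc j)" for h :: real
        by (cases "h \<le> 0") (auto simp: k)
      then show "\<forall>\<^sub>F h in at 0. norm (max 0 h ^ k / h) \<le> max 0 h ^ (Suc j)"
        by simp
      show "((\<lambda>h::real. max 0 h ^ (Suc j)) \<longlongrightarrow> 0) (at 0)"
        by (auto intro!: tendsto_eq_intros)
    qed
    then show ?thesis using 3 assms by (simp add: DERIV_def power_0_left k)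
  qed
qed

text \<open>The third power of the positive part is the smallest one for which the cutoff is \<open>C\<^sup>2\<close>.\<close>
definition bump :: "real \<Rightarrow> real \<Rightarrow> real" where
  "bump R x = max 0 (1 - (x / R)\<^sup>2) ^ 3"

definition bump_x :: "real \<Rightarrow> real \<Rightarrow> real" where
  "bump_x R x = - (6 * x / R\<^sup>2) * max 0 (1 - (x / R)\<^sup>2) ^ 2"

definition bump_xx :: "real \<Rightarrow> real \<Rightarrow> real" where
  "bump_xx R x = 24 * x\<^sup>2 / R ^ 4 * max 0 (1 - (x / R)\<^sup>2) - 6 / R\<^sup>2 * max 0 (1 - (x / R)\<^sup>2) ^ 2"

lemma pos_part_quadratic_power_DERIV:
  assumes "0 < R" "2 \<le> k"
  shows "((\<lambda>x. max 0 (1 - (x / R)\<^sup>2) ^ k) has_real_derivative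
           real k * max 0 (1 - (x / R)\<^sup>2) ^ (k - 1) * - (2 * x / R\<^sup>2)) (at x)"
proof -
  have "((\<lambda>x. 1 - (x / R)\<^sup>2) has_real_derivative - (2 * x / R\<^sup>2)) (at x)"
    by (rule derivative_eq_intros refl | use assms in \<open>simp add: field_simps power2_eq_square\<close>)+
  then show ?thesis by (rule DERIV_chain2[OF pos_part_power_DERIV[OF assms(2)]])
qed

lemma bump_DERIV:
  assumes "0 < R"
  shows "(bump R has_real_derivative bump_x R x) (at x)"
proof -
  have "bump_x R x = real 3 * max 0 (1 - (x / R)\<^sup>2) ^ (3 - 1) * - (2 * x / R\<^sup>2)"
    by (simp add: bump_x_def)
  then show ?thesis
    using pos_part_quadratic_power_DERIV[OF assms, of 3 x] unfolding bump_def[abs_def] by simp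
qed

lemma bump_x_DERIV:
  assumes "0 < R"
  shows "(bump_x R has_real_derivative bump_xx R x) (at x)"
proof -
  have 1: "((\<lambda>x. - (6 * x / R\<^sup>2)) has_real_derivative - (6 / R\<^sup>2)) (at x)"
  proof -
    have "(\<lambda>x. - (6 * x / R\<^sup>2)) = (*) (- (6 / R\<^sup>2))" by auto
    then show ?thesis using DERIV_cmult_Id[of "- (6 / R\<^sup>2)" x] by simp
  qed
  have 2: "((\<lambda>x. max 0 (1 - (x / R)\<^sup>2) ^ 2) has_real_derivative
      real 2 * max 0 (1 - (x / R)\<^sup>2) ^ (2 - 1) * - (2 * x / R\<^sup>2)) (at x)"
    by (rule pos_part_quadratic_power_DERIV) (use assms in auto)
  have "bump_xx R x = - (6 / R\<^sup>2) * max 0 (1 - (x / R)\<^sup>2) ^ 2 +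
      real 2 * max 0 (1 - (x / R)\<^sup>2) ^ (2 - 1) * - (2 * x / R\<^sup>2) * - (6 * x / R\<^sup>2)"
    using assms by (simp add: bump_xx_def power2_eq_square power4_eq_xxxx mult_ac)
  then show ?thesis
    using DERIV_mult[OF 1 2] unfolding bump_x_def[abs_def] by simp
qed

lemma bump_xx_continuous: "0 < R \<Longrightarrow> continuous_on UNIV (bump_xx R)"
  unfolding bump_xx_def[abs_def] by (intro continuous_intros) auto

lemma bump_outside: "0 < R \<Longrightarrow> R < \<bar>x\<bar> \<Longrightarrow> bump R x = 0"
proof -
  assume "0 < R" "R < \<bar>x\<bar>"
  then have "1\<^sup>2 < (\<bar>x\<bar> / R)\<^sup>2" by (intro power_strict_mono) auto
  then show ?thesis by (simp add: bump_def max_def power_divide)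
qed

lemma bump_nonneg: "0 \<le> bump R x" and bump_le_1: "bump R x \<le> 1"
  by (auto simp: bump_def intro!: power_le_one)

lemma bump_tendsto_1: "(\<lambda>n. bump (real (Suc n)) x) \<longlonglongrightarrow> 1"
proof -
  have "(\<lambda>n. (x * inverse (real (Suc n)))) \<longlonglongrightarrow> x * 0"
    by (rule tendsto_mult[OF tendsto_const LIMSEQ_inverse_real_of_nat])
  then have "(\<lambda>n. max 0 (1 - (x * inverse (real (Suc n)))\<^sup>2) ^ 3) \<longlonglongrightarrow> max 0 (1 - (x * 0)\<^sup>2) ^ 3"
    by (intro tendsto_power tendsto_max tendsto_diff tendsto_const)
  then show ?thesis by (simp add: bump_def divide_inverse)
qed

text \<open>Both bounds vanish as \<open>R \<rightarrow> \<infinity>\<close>, which makes the error of the truncation disappear.\<close>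
lemma bump_derivative_bounds:
  assumes "1 \<le> R"
  shows "\<bar>bump_x R x\<bar> \<le> 6 / R" and "\<bar>bump_xx R x\<bar> \<le> 30 / R"
proof -
  define m where "m = max 0 (1 - (x / R)\<^sup>2)"
  have m: "0 \<le> m" "m \<le> 1" by (auto simp: m_def)
  have m2: "m\<^sup>2 \<le> 1" using m by (intro power_le_one)
  have "\<bar>bump_x R x\<bar> \<le> 6 / R \<and> \<bar>bump_xx R x\<bar> \<le> 30 / R"
  proof (cases "\<bar>x\<bar> \<le> R")
    case True
    have y: "\<bar>x / R\<bar> \<le> 1" using True assms by simp
    have y2: "\<bar>(x / R)\<^sup>2\<bar> \<le> 1" using y by (simp add: abs_square_le_1)
    have R: "1 / R\<^sup>2 \<le> 1 / R" "0 < 1 / R" "0 < 1 / R\<^sup>2"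
      using assms by (auto simp: power2_eq_square intro!: divide_left_mono)
    have "\<bar>bump_x R x\<bar> = 6 / R * (\<bar>x / R\<bar> * m\<^sup>2)"
      using assms unfolding bump_x_def m_def[symmetric] by (simp add: abs_mult power2_eq_square)
    also have "\<dots> \<le> 6 / R * (1 * 1)"
      using y m2 assms by (intro mult_left_mono mult_mono) auto
    finally have 1: "\<bar>bump_x R x\<bar> \<le> 6 / R" by simp
    have "bump_xx R x = (24 * ((x / R)\<^sup>2 * m) - 6 * m\<^sup>2) * (1 / R\<^sup>2)"
      using assms unfolding bump_xx_def m_def[symmetric]
      by (simp add: field_simps power2_eq_square power4_eq_xxxx)
    moreover have "\<bar>24 * ((x / R)\<^sup>2 * m) - 6 * m\<^sup>2\<bar> \<le> 30"
    proof -
      have "\<bar>(x / R)\<^sup>2 * m\<bar> \<le> 1 * 1" unfolding abs_mult using y2 m by (intro mult_mono) auto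
      then show ?thesis using m2 by (smt (verit) zero_le_power2)
    qed
    ultimately have "\<bar>bump_xx R x\<bar> \<le> 30 * (1 / R\<^sup>2)"
      using R by (simp only: abs_mult) (intro mult_mono, auto)
    also have "\<dots> \<le> 30 / R" using R by simp
    finally show ?thesis using 1 by simp
  next
    case False
    then have "1\<^sup>2 < (\<bar>x\<bar> / R)\<^sup>2" using assms by (intro power_strict_mono) auto
    then have "m = 0" by (simp add: m_def power_divide)
    then show ?thesis using assms by (simp add: bump_x_def bump_xx_def m_def[symmetric])
  qed
  then show "\<bar>bump_x R x\<bar> \<le> 6 / R" "\<bar>bump_xx R x\<bar> \<le> 30 / R" by auto
qed

section \<open>Pairing a curve in \<open>L\<^sup>1\<close> with a moving test function\<close>

text \<open>The Bochner integral of a nonintegrable function is 0, so the inequality covers that case, too; it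
bounds \<open>nonlocal_birth\<close> even at points where the integral diverges.\<close>
lemma ennreal_lebesgue_integral_le:
  assumes "\<And>x. 0 \<le> f x"
  shows "ennreal (LINT x|M. f x) \<le> (\<integral>\<^sup>+x. ennreal (f x) \<partial>M)"
proof (cases "integrable M f")
  case True
  then show ?thesis using assms by (simp add: nn_integral_eq_integral)
next
  case False
  then show ?thesis by (simp add: not_integrable_integral_eq)
qed

lemma integrable_mult_bounded:
  fixes f p :: "real \<Rightarrow> real"
  assumes "integrable lborel f" "p \<in> borel_measurable borel" "\<And>x. \<bar>p x\<bar> \<le> M"
  shows "integrable lborel (\<lambda>x. f x * p x)" (is ?I)
    and "\<bar>LINT x|lborel. f x * p x\<bar> \<le> M * (LINT x|lborel. \<bar>f x\<bar>)" (is ?B)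
proof -
  have [measurable]: "p \<in> borel_measurable borel" "f \<in> borel_measurable borel"
    using assms borel_measurable_integrable[OF assms(1)] by auto
  have le: "\<bar>f x * p x\<bar> \<le> M * \<bar>f x\<bar>" for x
    using mult_left_mono[OF assms(3), of "\<bar>f x\<bar>" x] by (simp add: abs_mult mult.commute)
  have M: "integrable lborel (\<lambda>x. M * \<bar>f x\<bar>)" using assms(1) by simp
  show I: ?I
    by (rule Bochner_Integration.integrable_bound[OF M])
       (use le order_trans[OF _ abs_ge_self] in \<open>auto simp del: abs_mult\<close>)
  have "\<bar>LINT x|lborel. f x * p x\<bar> \<le> (LINT x|lborel. \<bar>f x * p x\<bar>)"
    by simp
  also have "\<dots> \<le> (LINT x|lborel. M * \<bar>f x\<bar>)"
    using I M le by (intro integral_mono) auto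
  finally show ?B by simp
qed

lemma L1_continuous_onD:
  assumes "L1_continuous_on S u" "s \<in> S"
  shows "integrable lborel (u s)"
    and "((\<lambda>r. LINT x|lborel. \<bar>u r x - u s x\<bar>) \<longlongrightarrow> 0) (at s within S)"
  using assms by (auto simp: L1_continuous_on_def)

lemma L1_continuous_on_pairing:
  assumes u: "L1_continuous_on S u" and "T \<subseteq> S"
    and meas: "\<And>s. s \<in> T \<Longrightarrow> p s \<in> borel_measurable borel"
    and bound: "\<And>s x. s \<in> T \<Longrightarrow> \<bar>p s x\<bar> \<le> M"
    and lip: "\<And>r s x. r \<in> T \<Longrightarrow> s \<in> T \<Longrightarrow> \<bar>p r x - p s x\<bar> \<le> L * \<bar>r - s\<bar>"
  shows "continuous_on T (\<lambda>s. LINT x|lborel. u s x * p s x)"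
  unfolding continuous_on_def
proof
  fix s assume s: "s \<in> T"
  have int: "integrable lborel (u r)" if "r \<in> T" for r
    using L1_continuous_onD(1)[OF u] that \<open>T \<subseteq> S\<close> by blast
  have L1: "((\<lambda>r. LINT x|lborel. \<bar>u r x - u s x\<bar>) \<longlongrightarrow> 0) (at s within T)"
    by (rule tendsto_within_subset[OF L1_continuous_onD(2)[OF u]]) (use s \<open>T \<subseteq> S\<close> in auto)
  have "((\<lambda>r. (LINT x|lborel. u r x * p r x) - (LINT x|lborel. u s x * p s x)) \<longlongrightarrow> 0) (at s within T)"
  proof (rule Lim_null_comparison)
    show "\<forall>\<^sub>F r in at s within T. norm ((LINT x|lborel. u r x * p r x) - (LINT x|lborel. u s x * p s x))
      \<le> M * (LINT x|lborel. \<bar>u r x - u s x\<bar>) + L * \<bar>r - s\<bar> * (LINT x|lborel. \<bar>u s x\<bar>)"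
      unfolding eventually_at_filter
    proof (intro always_eventually allI impI)
      fix r assume "r \<noteq> s" "r \<in> T"
      note r = \<open>r \<in> T\<close>
      have d: "integrable lborel (\<lambda>x. u r x - u s x)" using int r s by auto
      have dm: "(\<lambda>x. p r x - p s x) \<in> borel_measurable borel" using meas r s by auto
      note 1 = integrable_mult_bounded[OF d meas[OF r] bound[OF r]]
      note 2 = integrable_mult_bounded[OF int[OF s] dm lip[OF r s]]
      have "(LINT x|lborel. u r x * p r x) - (LINT x|lborel. u s x * p s x) =
        (LINT x|lborel. u r x * p r x - u s x * p s x)"
        by (intro Bochner_Integration.integral_diff[symmetric]
            integrable_mult_bounded(1)[OF int[OF r] meas[OF r] bound[OF r]]
            integrable_mult_bounded(1)[OF int[OF s] meas[OF s] bound[OF s]])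
      also have "\<dots> = (LINT x|lborel. (u r x - u s x) * p r x + u s x * (p r x - p s x))"
        by (simp add: algebra_simps)
      also have "\<dots> = (LINT x|lborel. (u r x - u s x) * p r x) + (LINT x|lborel. u s x * (p r x - p s x))"
        by (intro Bochner_Integration.integral_add 1 2)
      finally show "norm ((LINT x|lborel. u r x * p r x) - (LINT x|lborel. u s x * p s x))
        \<le> M * (LINT x|lborel. \<bar>u r x - u s x\<bar>) + L * \<bar>r - s\<bar> * (LINT x|lborel. \<bar>u s x\<bar>)"
        using 1(2) 2(2) by simp
    qed
    show "((\<lambda>r. M * (LINT x|lborel. \<bar>u r x - u s x\<bar>) + L * \<bar>r - s\<bar> * (LINT x|lborel. \<bar>u s x\<bar>)) \<longlongrightarrow> 0)
      (at s within T)"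
      by (rule tendsto_eq_intros L1 refl | simp)+
  qed
  then show "((\<lambda>s. LINT x|lborel. u s x * p s x) \<longlongrightarrow> (LINT x|lborel. u s x * p s x)) (at s within T)"
    by (simp add: LIM_zero_iff)
qed

lemma L1_continuous_on_norm_bounded:
  assumes u: "L1_continuous_on S u" and "compact T" "T \<subseteq> S"
  obtains U where "\<And>s. s \<in> T \<Longrightarrow> (LINT x|lborel. \<bar>u s x\<bar>) \<le> U"
proof -
  have "continuous_on T (\<lambda>s. LINT x|lborel. \<bar>u s x\<bar>)"
    unfolding continuous_on_def
  proof
    fix s assume s: "s \<in> T"
    have int: "integrable lborel (u r)" if "r \<in> T" for r
      using L1_continuous_onD(1)[OF u] that \<open>T \<subseteq> S\<close> by blast
    have L1: "((\<lambda>r. LINT x|lborel. \<bar>u r x - u s x\<bar>) \<longlongrightarrow> 0) (at s within T)"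
      by (rule tendsto_within_subset[OF L1_continuous_onD(2)[OF u]]) (use s \<open>T \<subseteq> S\<close> in auto)
    have le: "norm ((LINT x|lborel. \<bar>u r x\<bar>) - (LINT x|lborel. \<bar>u s x\<bar>)) \<le> (LINT x|lborel. \<bar>u r x - u s x\<bar>)"
      if r: "r \<in> T" for r
    proof -
      have "(LINT x|lborel. \<bar>u r x\<bar>) - (LINT x|lborel. \<bar>u s x\<bar>) = (LINT x|lborel. \<bar>u r x\<bar> - \<bar>u s x\<bar>)"
        using int r s by simp
      also have "norm \<dots> \<le> (LINT x|lborel. \<bar>\<bar>u r x\<bar> - \<bar>u s x\<bar>\<bar>)" by simp
      also have "\<dots> \<le> (LINT x|lborel. \<bar>u r x - u s x\<bar>)"
        using int r s by (intro integral_mono) auto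
      finally show ?thesis .
    qed
    have "((\<lambda>r. (LINT x|lborel. \<bar>u r x\<bar>) - (LINT x|lborel. \<bar>u s x\<bar>)) \<longlongrightarrow> 0) (at s within T)"
      by (rule Lim_null_comparison[OF _ L1]) (use le in \<open>auto simp: eventually_at_filter\<close>)
    then show "((\<lambda>s. LINT x|lborel. \<bar>u s x\<bar>) \<longlongrightarrow> (LINT x|lborel. \<bar>u s x\<bar>)) (at s within T)"
      by (simp add: LIM_zero_iff)
  qed
  then have "bounded ((\<lambda>s. LINT x|lborel. \<bar>u s x\<bar>) ` T)"
    using assms(2) by (intro compact_imp_bounded compact_continuous_image)
  then obtain U where "\<And>s. s \<in> T \<Longrightarrow> norm (LINT x|lborel. \<bar>u s x\<bar>) \<le> U"
    by (auto simp: bounded_iff)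
  then show ?thesis using that[of U] by (simp add: abs_le_iff)
qed

text \<open>Product rule: the derivative is the sum of the one with the test function frozen at time \<open>t\<close> and of
the one with \<open>u\<close> frozen. In the second part the difference quotients of \<open>p\<close> are bounded by \<open>L\<close>, so
that \<open>L\<^sup>1\<close> continuity of \<open>u\<close> permits replacing \<open>u s\<close> by \<open>u t\<close>, and dominated convergence applies.\<close>
lemma L1_continuous_on_pairing_DERIV:
  assumes u: "L1_continuous_on S u" and d: "0 < d" "{t - d<..<t + d} \<subseteq> S"
    and meas: "\<And>s. \<bar>s - t\<bar> < d \<Longrightarrow> p s \<in> borel_measurable borel"
    and bound: "\<And>s x. \<bar>s - t\<bar> < d \<Longrightarrow> \<bar>p s x\<bar> \<le> M"
    and lip: "\<And>s x. \<bar>s - t\<bar> < d \<Longrightarrow> \<bar>p s x - p t x\<bar> \<le> L * \<bar>s - t\<bar>"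
    and deriv: "\<And>x. ((\<lambda>s. p s x) has_real_derivative p' x) (at t)"
    and frozen: "((\<lambda>s. LINT x|lborel. u s x * p t x) has_real_derivative D) (at t)"
  shows "((\<lambda>s. LINT x|lborel. u s x * p s x) has_real_derivative
           D + (LINT x|lborel. u t x * p' x)) (at t)"
proof -
  have int: "integrable lborel (u s)" if "\<bar>s - t\<bar> < d" for s
    using L1_continuous_onD(1)[OF u, of s] that d by (auto simp: abs_less_iff subset_eq)
  have t: "\<bar>t - t\<bar> < d" using d by simp
  have tS: "t \<in> S" using d by auto
  have "t \<in> interior S" using d by (intro interiorI[OF _ _ d(2)]) auto
  then have L1: "((\<lambda>r. LINT x|lborel. \<bar>u r x - u t x\<bar>) \<longlongrightarrow> 0) (at t)"
    using L1_continuous_onD(2)[OF u tS] at_within_interior by metis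
  have near: "\<forall>\<^sub>F s in at t. \<bar>s - t\<bar> < d"
    using d by (auto simp: eventually_at dist_real_def intro!: exI[of _ d])
  have nearn: "\<forall>\<^sub>F s in nhds t. \<bar>s - t\<bar> < d"
    using d by (auto simp: eventually_nhds_metric dist_real_def intro!: exI[of _ d])
  have L: "0 \<le> L"
    using lip[of "t + d / 2" 0] d by (smt (verit) abs_ge_zero zero_le_mult_iff field_sum_of_halves)
  \<comment> \<open>The difference quotients, set to 0 away from \<open>t\<close> so that the bound \<open>L\<close> holds for all \<open>s\<close>.\<close>
  define q where "q s x = (if \<bar>s - t\<bar> < d then (p s x - p t x) / (s - t) else 0)" for s x
  have q_meas: "q s \<in> borel_measurable borel" for s
    using meas[of s] meas[OF t] unfolding q_def by (cases "\<bar>s - t\<bar> < d") simp_all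
  have q_le: "\<bar>q s x\<bar> \<le> L" for s x
    using lip[of s x] L by (cases "s = t") (auto simp: q_def divide_le_eq)
  have q_lim: "((\<lambda>s. q s x) \<longlongrightarrow> p' x) (at t)" for x
  proof -
    have "((\<lambda>s. (p s x - p t x) / (s - t)) \<longlongrightarrow> p' x) (at t)"
      using deriv[of x] by (simp add: has_field_derivative_iff)
    then show ?thesis
      by (rule Lim_transform_eventually) (use near in \<open>auto elim!: eventually_mono simp: q_def\<close>)
  qed
  have p'_meas: "p' \<in> borel_measurable borel"
  proof (rule borel_measurable_LIMSEQ_real)
    show "q (t + inverse (real (Suc n))) \<in> borel_measurable borel" for n by (rule q_meas)
    have lim: "filterlim (\<lambda>n. t + inverse (real (Suc n))) (at t) sequentially"
      unfolding filterlim_at using LIMSEQ_inverse_real_of_nat_add[of t] by auto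
    show "(\<lambda>n. q (t + inverse (real (Suc n))) x) \<longlonglongrightarrow> p' x" for x
      by (rule filterlim_compose[OF q_lim lim])
  qed
  have 1: "((\<lambda>s. LINT x|lborel. (u s x - u t x) * q s x) \<longlongrightarrow> 0) (at t)"
  proof (rule Lim_null_comparison)
    show "\<forall>\<^sub>F s in at t. norm (LINT x|lborel. (u s x - u t x) * q s x) \<le> L * (LINT x|lborel. \<bar>u s x - u t x\<bar>)"
      using near
    proof eventually_elim
      case (elim s)
      have "integrable lborel (\<lambda>x. u s x - u t x)" using int[OF elim] int[OF t] by simp
      from integrable_mult_bounded(2)[OF this q_meas q_le] show ?case by simp
    qed
    show "((\<lambda>s. L * (LINT x|lborel. \<bar>u s x - u t x\<bar>)) \<longlongrightarrow> 0) (at t)"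
      using tendsto_mult[OF tendsto_const L1, of L] by simp
  qed
  have 2: "((\<lambda>s. LINT x|lborel. u t x * q s x) \<longlongrightarrow> (LINT x|lborel. u t x * p' x)) (at t)"
    unfolding tendsto_at_iff_sequentially comp_def
  proof (intro allI impI)
    fix X assume X: "\<forall>i. X i \<in> UNIV - {t}" "X \<longlonglongrightarrow> t"
    have lim: "filterlim X (at t) sequentially" using X by (auto simp: filterlim_at)
    have um: "u t \<in> borel_measurable lborel" using int[OF t] by auto
    show "(\<lambda>n. LINT x|lborel. u t x * q (X n) x) \<longlonglongrightarrow> (LINT x|lborel. u t x * p' x)"
    proof (rule integral_dominated_convergence)
      show "integrable lborel (\<lambda>x. \<bar>u t x\<bar> * L)" using int[OF t] by simp
      show "AE x in lborel. (\<lambda>n. u t x * q (X n) x) \<longlonglongrightarrow> u t x * p' x"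
        by (intro AE_I2 tendsto_mult tendsto_const filterlim_compose[OF q_lim lim])
      show "AE x in lborel. norm (u t x * q (X n) x) \<le> \<bar>u t x\<bar> * L" for n
        using q_le by (intro AE_I2) (auto simp: abs_mult intro!: mult_left_mono)
    qed (use um p'_meas q_meas in auto)
  qed
  have "((\<lambda>s. LINT x|lborel. u s x * (p s x - p t x)) has_real_derivative (LINT x|lborel. u t x * p' x)) (at t)"
    unfolding has_field_derivative_iff
  proof (rule Lim_transform_eventually)
    show "((\<lambda>s. (LINT x|lborel. (u s x - u t x) * q s x) + (LINT x|lborel. u t x * q s x)) \<longlongrightarrow>
      (LINT x|lborel. u t x * p' x)) (at t)"
      using tendsto_add[OF 1 2] by simp
    show "\<forall>\<^sub>F s in at t. (LINT x|lborel. (u s x - u t x) * q s x) + (LINT x|lborel. u t x * q s x) =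
      ((LINT x|lborel. u s x * (p s x - p t x)) - (LINT x|lborel. u t x * (p t x - p t x))) / (s - t)"
      using near
    proof eventually_elim
      case (elim s)
      have d: "integrable lborel (\<lambda>x. u s x - u t x)" using int[OF elim] int[OF t] by simp
      have "(LINT x|lborel. (u s x - u t x) * q s x) + (LINT x|lborel. u t x * q s x) =
        (LINT x|lborel. (u s x - u t x) * q s x + u t x * q s x)"
        by (intro Bochner_Integration.integral_add[symmetric]
            integrable_mult_bounded(1)[OF d q_meas q_le]
            integrable_mult_bounded(1)[OF int[OF t] q_meas q_le])
      also have "\<dots> = (LINT x|lborel. u s x * (p s x - p t x) / (s - t))"
        using elim by (intro Bochner_Integration.integral_cong) (auto simp: q_def algebra_simps diff_divide_distrib)
      finally show ?case by simp
    qed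
  qed
  then have sum: "((\<lambda>s. (LINT x|lborel. u s x * p t x) + (LINT x|lborel. u s x * (p s x - p t x)))
      has_real_derivative D + (LINT x|lborel. u t x * p' x)) (at t)"
    by (rule DERIV_add[OF frozen])
  have "\<forall>\<^sub>F s in nhds t. (LINT x|lborel. u s x * p t x) + (LINT x|lborel. u s x * (p s x - p t x)) =
      (LINT x|lborel. u s x * p s x)"
    using nearn
  proof eventually_elim
    case (elim s)
    have dm: "(\<lambda>x. p s x - p t x) \<in> borel_measurable borel" using meas[OF elim] meas[OF t] by simp
    have "(LINT x|lborel. u s x * p t x) + (LINT x|lborel. u s x * (p s x - p t x)) =
      (LINT x|lborel. u s x * p t x + u s x * (p s x - p t x))"
      by (intro Bochner_Integration.integral_add[symmetric]
          integrable_mult_bounded(1)[OF int[OF elim] meas[OF t] bound[OF t]]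
          integrable_mult_bounded(1)[OF int[OF elim] dm lip[OF elim]])
    then show ?case by (simp add: algebra_simps)
  qed
  from DERIV_cong_ev[OF refl this refl] sum show ?thesis by blast
qed

section \<open>Heat means\<close>

text \<open>Values are extended reals, so that bounds can be stated before integrability is known and Tonelli
and Fatou apply directly.\<close>
definition heat_mean :: "(real \<Rightarrow> real) \<Rightarrow> real \<Rightarrow> real \<Rightarrow> ennreal" where
  "heat_mean v s y = (\<integral>\<^sup>+x. ennreal (v x * heat_kernel s (x - y)) \<partial>lborel)"

text \<open>Moving the weight onto the kernel by \<open>heat_kernel_exp_shift\<close> leaves an unweighted heat mean of
\<open>exp (- l x) v\<close>. The kernel has mass 1 and height \<open>1 / sqrt (4 \<pi> s)\<close>, which gives the bounds by the
\<open>L\<^sup>\<infinity>\<close> norm and by the \<open>L\<^sup>1\<close> norm.\<close>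
lemma heat_mean_weighted:
  assumes s: "0 < s" and v: "\<And>x. 0 \<le> v x"
    and int: "integrable lborel (\<lambda>x. exp (- l * x) * v x)"
    and K1: "(LINT x|lborel. \<bar>exp (- l * x) * v x\<bar>) \<le> K"
    and K2: "AE x in lborel. \<bar>exp (- l * x) * v x\<bar> \<le> K"
  shows "heat_mean v s y \<le> ennreal (K * exp (l * y + l\<^sup>2 * s))"
    and "heat_mean v s y \<le> ennreal (K / sqrt (4 * pi * s) * exp (l * y + l\<^sup>2 * s))"
proof -
  define w where "w = (\<lambda>x. exp (- l * x) * v x)"
  define E where "E = exp (l * y + l\<^sup>2 * s)"
  define z where "z = y + 2 * l * s"
  have w: "0 \<le> w x" for x using v by (simp add: w_def)
  have intw: "integrable lborel w" using int by (simp add: w_def)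
  have K1': "(LINT x|lborel. w x) \<le> K" using K1 w by (simp add: w_def)
  have K2': "AE x in lborel. w x \<le> K" using K2 by eventually_elim (simp add: w_def)
  have K: "0 \<le> K" using K1' w by (meson Bochner_Integration.integral_nonneg order_trans)
  have E: "0 < E" by (simp add: E_def)
  have "v x * heat_kernel s (x - y) = w x * (exp (l * x) * heat_kernel s (x - y))" for x
    by (simp add: w_def flip: exp_add)
  also have "\<dots> x = w x * (E * heat_kernel s (x - z))" for x
    unfolding heat_kernel_exp_shift[OF s] E_def z_def ..
  finally have eq: "heat_mean v s y = (\<integral>\<^sup>+x. ennreal (w x * (E * heat_kernel s (x - z))) \<partial>lborel)"
    by (simp add: heat_mean_def)
  have "heat_mean v s y \<le> (\<integral>\<^sup>+x. ennreal (K * E) * ennreal (heat_kernel s (x - z)) \<partial>lborel)"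
    unfolding eq
  proof (rule nn_integral_mono_AE, use K2' in eventually_elim)
    case (elim x)
    have "w x * (E * heat_kernel s (x - z)) \<le> K * (E * heat_kernel s (x - z))"
      using elim E heat_kernel_nonneg[OF s] by (intro mult_right_mono) auto
    then show ?case using K E heat_kernel_nonneg[OF s, of "x - z"]
      by (auto simp: mult.assoc simp flip: ennreal_mult intro!: ennreal_leI)
  qed
  also have "\<dots> = ennreal (K * E)"
    by (subst nn_integral_cmult) (auto simp: nn_integral_heat_kernel[OF s])
  finally show "heat_mean v s y \<le> ennreal (K * exp (l * y + l\<^sup>2 * s))" by (simp add: E_def)
  have "heat_mean v s y \<le> (\<integral>\<^sup>+x. ennreal (E / sqrt (4 * pi * s)) * ennreal (w x) \<partial>lborel)"
    unfolding eq
  proof (rule nn_integral_mono)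
    fix x
    have "heat_kernel s (x - z) \<le> 1 / sqrt (4 * pi * s)"
      unfolding heat_kernel_def using s by (intro divide_right_mono) auto
    then have "w x * (E * heat_kernel s (x - z)) \<le> w x * (E * (1 / sqrt (4 * pi * s)))"
      using w E by (intro mult_left_mono) auto
    then show "ennreal (w x * (E * heat_kernel s (x - z))) \<le> ennreal (E / sqrt (4 * pi * s)) * ennreal (w x)"
      using w E s by (auto simp: mult_ac simp flip: ennreal_mult intro!: ennreal_leI)
  qed
  also have "\<dots> = ennreal (E / sqrt (4 * pi * s)) * ennreal (LINT x|lborel. w x)"
    using intw w by (subst nn_integral_cmult) (auto simp: nn_integral_eq_integral)
  also have "\<dots> \<le> ennreal (E / sqrt (4 * pi * s)) * ennreal K"
    using K1' by (intro mult_left_mono ennreal_leI) auto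
  also have "\<dots> = ennreal (K / sqrt (4 * pi * s) * exp (l * y + l\<^sup>2 * s))"
    using E K s by (auto simp: E_def mult_ac simp flip: ennreal_mult)
  finally show "heat_mean v s y \<le> ennreal (K / sqrt (4 * pi * s) * exp (l * y + l\<^sup>2 * s))" .
qed

text \<open>As \<open>s \<rightarrow> 0\<close> heat means approximate \<open>v y\<close>. Only the upper bound is wanted, so Fatou's lemma suffices;
rescaling \<open>x = y + sqrt s * z\<close> makes the kernel independent of \<open>s\<close>.\<close>
lemma le_lim_of_heat_mean_le:
  assumes cont: "continuous_on UNIV v" and v: "\<And>x. 0 \<le> v x"
    and le: "\<And>s. 0 < s \<Longrightarrow> heat_mean v s y \<le> ennreal (H s)"
    and lim: "(H \<longlongrightarrow> H0) (at_right 0)" and H0: "0 \<le> H0"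
  shows "v y \<le> H0"
proof -
  define r where "r n = inverse (real (Suc n))" for n
  have r: "0 < r n" for n by (simp add: r_def)
  have r0: "r \<longlonglongrightarrow> 0" unfolding r_def[abs_def] by (rule LIMSEQ_inverse_real_of_nat)
  have vm [measurable]: "v \<in> borel_measurable borel"
    using cont by (rule borel_measurable_continuous_onI)
  have scale: "heat_mean v ((r n)\<^sup>2) y = (\<integral>\<^sup>+z. ennreal (v (y + r n * z) * heat_kernel 1 z) \<partial>lborel)" for n
  proof -
    have k: "r n * heat_kernel ((r n)\<^sup>2) (r n * z) = heat_kernel 1 z" for z
      using r[of n] by (simp add: heat_kernel_def real_sqrt_mult power_mult_distrib)
    have "heat_mean v ((r n)\<^sup>2) y =
      ennreal \<bar>r n\<bar> * (\<integral>\<^sup>+z. ennreal (v (y + r n * z) * heat_kernel ((r n)\<^sup>2) (y + r n * z - y)) \<partial>lborel)"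
      unfolding heat_mean_def using r[of n] by (intro nn_integral_real_affine) auto
    also have "\<dots> = (\<integral>\<^sup>+z. ennreal \<bar>r n\<bar> * ennreal (v (y + r n * z) * heat_kernel ((r n)\<^sup>2) (y + r n * z - y)) \<partial>lborel)"
      by (rule nn_integral_cmult[symmetric]) auto
    also have "\<dots> = (\<integral>\<^sup>+z. ennreal (v (y + r n * z) * heat_kernel 1 z) \<partial>lborel)"
      using r[of n] v heat_kernel_nonneg[of "(r n)\<^sup>2"] k
      by (intro nn_integral_cong) (simp add: mult_ac flip: ennreal_mult k)
    finally show ?thesis .
  qed
  have "ennreal (v y) = (\<integral>\<^sup>+z. ennreal (v y) * ennreal (heat_kernel 1 z) \<partial>lborel)"
    using nn_integral_heat_kernel[of 1 0] by (subst nn_integral_cmult) auto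
  also have "\<dots> = (\<integral>\<^sup>+z. liminf (\<lambda>n. ennreal (v (y + r n * z) * heat_kernel 1 z)) \<partial>lborel)"
  proof (rule nn_integral_cong)
    fix z
    have "(\<lambda>n. y + r n * z) \<longlonglongrightarrow> y + 0 * z" by (intro tendsto_intros r0)
    then have "(\<lambda>n. y + r n * z) \<longlonglongrightarrow> y" by simp
    then have "(\<lambda>n. v (y + r n * z)) \<longlonglongrightarrow> v y"
      using cont by (auto simp: continuous_on_eq_continuous_at isCont_def intro: isCont_tendsto_compose)
    then have "(\<lambda>n. ennreal (v (y + r n * z) * heat_kernel 1 z)) \<longlonglongrightarrow> ennreal (v y * heat_kernel 1 z)"
      by (intro tendsto_ennrealI tendsto_mult tendsto_const)
    from lim_imp_Liminf[OF _ this] show "ennreal (v y) * ennreal (heat_kernel 1 z) =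
      liminf (\<lambda>n. ennreal (v (y + r n * z) * heat_kernel 1 z))"
      using v heat_kernel_nonneg[of 1] by (simp flip: ennreal_mult)
  qed
  also have "\<dots> \<le> liminf (\<lambda>n. heat_mean v ((r n)\<^sup>2) y)"
    unfolding scale by (intro nn_integral_liminf) auto
  also have "\<dots> \<le> liminf (\<lambda>n. ennreal (H ((r n)\<^sup>2)))"
    using r by (intro Liminf_mono always_eventually allI le zero_less_power)
  also have "\<dots> = ennreal H0"
  proof (rule lim_imp_Liminf)
    have "(\<lambda>n. (r n)\<^sup>2) \<longlonglongrightarrow> 0" using tendsto_power[OF r0, of 2] by simp
    moreover have "r n \<noteq> 0" for n using r[of n] by simp
    ultimately have "filterlim (\<lambda>n. (r n)\<^sup>2) (at_right 0) sequentially"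
      by (simp add: filterlim_at)
    from filterlim_compose[OF lim this] show "(\<lambda>n. ennreal (H ((r n)\<^sup>2))) \<longlonglongrightarrow> ennreal H0"
      by (rule tendsto_ennrealI)
  qed simp
  finally show ?thesis using H0 by simp
qed

text \<open>By Tonelli the pairing of the source with a heat kernel is at most the average, with respect to
\<open>\<gamma> k0\<close>, of heat means of \<open>v\<close> with shifted centres \<open>y - z\<close>. A bound proportional to
\<open>exp (l z)\<close> therefore reproduces itself, with the exponential moment of \<open>k0\<close> as a factor.\<close>
lemma birth_pairing_le:
  assumes s: "0 < s" and v: "\<And>x. 0 \<le> v x" "v \<in> borel_measurable borel"
    and g: "\<And>z. 0 \<le> z \<Longrightarrow> 0 \<le> g z" "\<And>z. 0 \<le> z \<Longrightarrow> g z \<le> \<gamma> * z" and "0 \<le> \<gamma>"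
    and k0: "\<And>z. 0 \<le> k0 z" "k0 \<in> borel_measurable borel"
    and kint: "integrable lborel (\<lambda>z. k0 z * exp (- l * z))"
    and p: "\<And>x. 0 \<le> p x" "\<And>x. p x \<le> heat_kernel s (x - y)"
    and mean: "\<And>z. heat_mean v s z \<le> ennreal (Q * exp (l * z))" and Q: "0 \<le> Q"
  shows "(LINT x|lborel. nonlocal_birth g k0 v x * p x) \<le>
           \<gamma> * Q * exp (l * y) * (LINT z|lborel. k0 z * exp (- l * z))"
proof -
  note [measurable] = v(2) k0(2)
  have N: "0 \<le> nonlocal_birth g k0 v x" for x
    unfolding nonlocal_birth_def using k0(1) g(1) v(1) by (intro Bochner_Integration.integral_nonneg) auto
  have "ennreal (LINT x|lborel. nonlocal_birth g k0 v x * p x) \<le>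
      (\<integral>\<^sup>+x. ennreal (nonlocal_birth g k0 v x * p x) \<partial>lborel)"
    using N p by (intro ennreal_lebesgue_integral_le) auto
  also have "\<dots> \<le> (\<integral>\<^sup>+x. (\<integral>\<^sup>+z. ennreal (k0 z * \<gamma>) * ennreal (v (x - z) * heat_kernel s (x - y)) \<partial>lborel) \<partial>lborel)"
  proof (rule nn_integral_mono)
    fix x
    have "ennreal (nonlocal_birth g k0 v x) \<le> (\<integral>\<^sup>+z. ennreal (k0 z * g (v (x - z))) \<partial>lborel)"
      unfolding nonlocal_birth_def using k0(1) g(1) v(1) by (intro ennreal_lebesgue_integral_le) auto
    also have "\<dots> \<le> (\<integral>\<^sup>+z. ennreal (k0 z * (\<gamma> * v (x - z))) \<partial>lborel)"
      using k0(1) g(2) v(1) by (intro nn_integral_mono ennreal_leI mult_left_mono) auto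
    finally have "ennreal (nonlocal_birth g k0 v x) * ennreal (p x) \<le>
        (\<integral>\<^sup>+z. ennreal (k0 z * (\<gamma> * v (x - z))) \<partial>lborel) * ennreal (heat_kernel s (x - y))"
      using p by (intro mult_mono ennreal_leI) auto
    also have "\<dots> = (\<integral>\<^sup>+z. ennreal (k0 z * (\<gamma> * v (x - z))) * ennreal (heat_kernel s (x - y)) \<partial>lborel)"
      by (rule nn_integral_multc[symmetric]) measurable
    also have "\<dots> = (\<integral>\<^sup>+z. ennreal (k0 z * \<gamma>) * ennreal (v (x - z) * heat_kernel s (x - y)) \<partial>lborel)"
      using k0(1) v(1) \<open>0 \<le> \<gamma>\<close> heat_kernel_nonneg[OF s]
      by (intro nn_integral_cong) (simp add: mult_ac flip: ennreal_mult)
    finally show "ennreal (nonlocal_birth g k0 v x * p x) \<le>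
        (\<integral>\<^sup>+z. ennreal (k0 z * \<gamma>) * ennreal (v (x - z) * heat_kernel s (x - y)) \<partial>lborel)"
      using N p by (simp add: ennreal_mult)
  qed
  also have "\<dots> = (\<integral>\<^sup>+z. (\<integral>\<^sup>+x. ennreal (k0 z * \<gamma>) * ennreal (v (x - z) * heat_kernel s (x - y)) \<partial>lborel) \<partial>lborel)"
    by (rule lborel_pair.Fubini') measurable
  also have "\<dots> = (\<integral>\<^sup>+z. ennreal (k0 z * \<gamma>) * heat_mean v s (y - z) \<partial>lborel)"
  proof (rule nn_integral_cong)
    fix z
    have "(\<integral>\<^sup>+x. ennreal (v (x - z) * heat_kernel s (x - y)) \<partial>lborel) =
      ennreal \<bar>1\<bar> * (\<integral>\<^sup>+x. ennreal (v (z + 1 * x - z) * heat_kernel s (z + 1 * x - y)) \<partial>lborel)"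
      by (intro nn_integral_real_affine) auto
    also have "\<dots> = heat_mean v s (y - z)"
      by (simp add: heat_mean_def algebra_simps)
    finally show "(\<integral>\<^sup>+x. ennreal (k0 z * \<gamma>) * ennreal (v (x - z) * heat_kernel s (x - y)) \<partial>lborel) =
       ennreal (k0 z * \<gamma>) * heat_mean v s (y - z)"
      by (subst nn_integral_cmult) auto
  qed
  also have "\<dots> \<le> (\<integral>\<^sup>+z. ennreal (\<gamma> * Q * exp (l * y) * (k0 z * exp (- l * z))) \<partial>lborel)"
  proof (rule nn_integral_mono)
    fix z
    have "ennreal (k0 z * \<gamma>) * heat_mean v s (y - z) \<le> ennreal (k0 z * \<gamma>) * ennreal (Q * exp (l * (y - z)))"
      by (intro mult_left_mono mean) auto
    also have "\<dots> = ennreal (\<gamma> * Q * exp (l * y) * (k0 z * exp (- l * z)))"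
    proof -
      have "exp (l * (y - z)) = exp (l * y) * exp (- l * z)" by (simp add: algebra_simps flip: exp_add)
      then show ?thesis using k0(1)[of z] \<open>0 \<le> \<gamma>\<close> Q by (simp add: mult_ac flip: ennreal_mult)
    qed
    finally show "ennreal (k0 z * \<gamma>) * heat_mean v s (y - z) \<le> \<dots>" .
  qed
  also have "\<dots> = ennreal (LINT z|lborel. \<gamma> * Q * exp (l * y) * (k0 z * exp (- l * z)))"
    using kint k0(1) \<open>0 \<le> \<gamma>\<close> Q by (intro nn_integral_eq_integral) auto
  finally have "ennreal (LINT x|lborel. nonlocal_birth g k0 v x * p x) \<le>
    ennreal (\<gamma> * Q * exp (l * y) * (LINT z|lborel. k0 z * exp (- l * z)))" by simp
  moreover have "0 \<le> \<gamma> * Q * exp (l * y) * (LINT z|lborel. k0 z * exp (- l * z))"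
    using \<open>0 \<le> \<gamma>\<close> Q k0(1) by simp
  ultimately show ?thesis by (simp only: ennreal_le_iff)
qed

section \<open>Comparison with a barrier\<close>

text \<open>The loss incurred by looking back a time \<open>d\<close> on the clock of the barrier: for \<open>d \<le> \<tau> / 2\<close> it is at
most three times the first-order term \<open>d / (2 \<tau> sqrt \<tau>)\<close>. With \<open>r = d / \<tau>\<close> this is
\<open>1 \<le> (1 - r) (1 + 3 r / 2)\<^sup>2\<close>.\<close>
lemma inverse_sqrt_delay_le:
  fixes d \<tau> :: real
  assumes "0 \<le> d" "0 < \<tau>" "2 * d \<le> \<tau>"
  shows "1 / sqrt (\<tau> - d) \<le> 1 / sqrt \<tau> + 3 * d / (2 * \<tau> * sqrt \<tau>)"
proof -
  define r where "r = d / \<tau>"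
  have r: "0 \<le> r" "r \<le> 1 / 2" using assms by (auto simp: r_def field_simps)
  have "r * r \<le> r * (1 / 2)" "r * (r * r) \<le> r * (1 / 4)"
    using r mult_mono[of r "1/2" r "1/2"] by (intro mult_left_mono; simp)+
  moreover have "(1 - r) * (1 + 3 * r / 2)\<^sup>2 = 1 + 2 * r - 3 / 4 * (r * r) - 9 / 4 * (r * (r * r))"
    by (simp add: power2_eq_square field_simps)
  ultimately have "1 \<le> (1 - r) * (1 + 3 * r / 2)\<^sup>2"
    using r by linarith
  then have "sqrt 1 \<le> sqrt ((1 - r) * (1 + 3 * r / 2)\<^sup>2)" by (rule real_sqrt_le_mono)
  then have 1: "1 \<le> sqrt (1 - r) * (1 + 3 * r / 2)" using r by (simp add: real_sqrt_mult)
  have "\<tau> - d = \<tau> * (1 - r)" using assms by (simp add: r_def algebra_simps)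
  then have 2: "sqrt (\<tau> - d) = sqrt \<tau> * sqrt (1 - r)" by (simp add: real_sqrt_mult)
  have pos: "0 < sqrt \<tau>" "0 < sqrt (1 - r)" using assms r by auto
  have "1 / sqrt (1 - r) \<le> 1 + 3 * r / 2"
    using 1 pos by (simp add: divide_le_eq mult.commute)
  then have "1 / sqrt (1 - r) / sqrt \<tau> \<le> (1 + 3 * r / 2) / sqrt \<tau>"
    using pos by (intro divide_right_mono) auto
  also have "\<dots> = 1 / sqrt \<tau> + 3 * d / (2 * \<tau> * sqrt \<tau>)"
    using assms by (simp add: r_def field_simps)
  finally show ?thesis by (simp add: 2 mult.commute)
qed

text \<open>The situation at one point \<open>l\<close> where the two characteristic curves meet, \<open>p\<close> being the common
value; \<open>l\<close> may have either sign.\<close>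
locale linearly_controlled_solution =
  fixes h \<gamma> l c p :: real and g k0 :: "real \<Rightarrow> real" and u0 u :: "real \<Rightarrow> real \<Rightarrow> real"
  assumes h: "0 < h" and \<gamma>: "0 \<le> \<gamma>"
    and g_nonneg: "\<And>z. 0 \<le> z \<Longrightarrow> 0 \<le> g z" and g_le: "\<And>z. 0 \<le> z \<Longrightarrow> g z \<le> \<gamma> * z"
    and k0_nonneg: "\<And>z. 0 \<le> k0 z" and k0_meas: "k0 \<in> borel_measurable borel"
    and k0_exp: "integrable lborel (\<lambda>z. k0 z * exp (- l * z))"
    and p_f1: "p = f1 c l" and p_f2: "p = f2 \<gamma> h k0 c l"
    and sol: "solves_ivp h g k0 u0 u"
begin

lemma p_nonneg: "0 \<le> p"
  unfolding p_f2 f2_def using \<gamma> k0_nonneg by (intro mult_nonneg_nonneg Bochner_Integration.integral_nonneg) auto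

text \<open>The speed of the clock in the barrier. It solves \<open>3 p \<alpha> h = 1 - \<alpha>\<close>, the balance between the cost of
the delay (the constant 3 is that of \<open>inverse_sqrt_delay_le\<close>) and the gain from diffusion.\<close>
definition \<alpha> :: real where "\<alpha> = 1 / (1 + 3 * p * h)"

lemma \<alpha>: "0 < \<alpha>" "\<alpha> \<le> 1" "3 * p * (\<alpha> * h) = 1 - \<alpha>"
proof -
  have "0 < 1 + 3 * p * h" using p_nonneg h by (simp add: add_pos_nonneg)
  then show "0 < \<alpha>" "\<alpha> \<le> 1" "3 * p * (\<alpha> * h) = 1 - \<alpha>"
    using p_nonneg h by (auto simp: \<alpha>_def field_simps)
qed

text \<open>The amount of diffusion credited to a particle. The offset \<open>2 \<alpha> h\<close> keeps the clock positive on
\<open>[-h, 0]\<close> and, for \<open>t \<ge> 0\<close>, makes it at least twice the delay \<open>\<alpha> h\<close>.\<close>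
definition clock :: "real \<Rightarrow> real \<Rightarrow> real" where
  "clock t s = s + \<alpha> * t + 2 * \<alpha> * h"

definition barrier :: "real \<Rightarrow> real \<Rightarrow> real \<Rightarrow> real \<Rightarrow> real" where
  "barrier C t s y = C / sqrt (clock t s) * exp (l * (y + c * t) + l\<^sup>2 * s)"

lemma clock_ge: "0 \<le> t \<Longrightarrow> 0 \<le> s \<Longrightarrow> 2 * (\<alpha> * h) \<le> clock t s"
  using \<alpha> by (simp add: clock_def)

lemma clock_pos: "- h \<le> t \<Longrightarrow> 0 \<le> s \<Longrightarrow> 0 < clock t s"
proof -
  assume "- h \<le> t" "0 \<le> s"
  then have "\<alpha> * (- h) \<le> \<alpha> * t" using \<alpha> by (intro mult_left_mono) auto
  moreover have "0 < \<alpha> * h" using \<alpha> h by simp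
  ultimately show ?thesis using \<open>0 \<le> s\<close> unfolding clock_def mult.assoc by (simp; linarith)
qed

lemma barrier_nonneg: "0 \<le> C \<Longrightarrow> - h \<le> t \<Longrightarrow> 0 \<le> s \<Longrightarrow> 0 \<le> barrier C t s y"
  using clock_pos[of t s] by (simp add: barrier_def)

text \<open>The bound that \<open>birth_pairing_le\<close> yields for the source when the barrier holds at time \<open>t - h\<close>: by
\<open>p = f2 \<gamma> h k0 c l\<close> it is \<open>p\<close> times the barrier at time \<open>t\<close>, except that the clock is set back by
\<open>\<alpha> h\<close>.\<close>
lemma barrier_delay:
  "\<gamma> * (C / sqrt (clock (t - h) s) * exp (l * (c * (t - h)) + l\<^sup>2 * s)) * exp (l * y) *
     (LINT z|lborel. k0 z * exp (- l * z)) =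
   p * (C / sqrt (clock t s - \<alpha> * h)) * exp (l * (y + c * t) + l\<^sup>2 * s)"
proof -
  have 1: "clock (t - h) s = clock t s - \<alpha> * h" by (simp add: clock_def algebra_simps)
  have 2: "exp (l * (c * (t - h)) + l\<^sup>2 * s) * exp (l * y) =
      exp (- l * c * h) * exp (l * (y + c * t) + l\<^sup>2 * s)"
    by (simp add: algebra_simps flip: exp_add)
  have 3: "p = \<gamma> * exp (- l * c * h) * (LINT z|lborel. k0 z * exp (- l * z))"
    by (simp add: p_f2 f2_def)
  have "\<gamma> * (C / S * e1) * e2 * I = \<gamma> * e3 * I * (C / S) * e4" if "e1 * e2 = e3 * e4" for S e1 e2 e3 e4 I :: real
  proof -
    have "\<gamma> * (C / S * e1) * e2 * I = \<gamma> * (C / S) * I * (e1 * e2)" by (simp only: mult_ac)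
    then show ?thesis unfolding that by (simp only: mult_ac)
  qed
  from this[OF 2, of "sqrt (clock t s - \<alpha> * h)" "LINT z|lborel. k0 z * exp (- l * z)"]
  show ?thesis unfolding 1 3[symmetric] .
qed

text \<open>On the line \<open>s + t = s1\<close> the exponential factor grows at the rate \<open>l c - l\<^sup>2 = p - 1\<close>, by
\<open>p = f1 c l\<close>, and the clock runs backwards at the rate \<open>1 - \<alpha>\<close>. The resulting increase of
\<open>1 / sqrt (clock t s)\<close> pays for the delay in the source.\<close>
lemma barrier_along_characteristic:
  assumes C: "0 \<le> C" and t: "0 \<le> t" "t < s1"
  shows "\<exists>D. ((\<lambda>t. barrier C t (s1 - t) y) has_real_derivative D) (at t) \<and>
    p * (C / sqrt (clock t (s1 - t) - \<alpha> * h)) * exp (l * (y + c * t) + l\<^sup>2 * (s1 - t))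
      \<le> D + barrier C t (s1 - t) y"
proof -
  define \<tau> where "\<tau> = clock t (s1 - t)"
  define E where "E = exp (l * (y + c * t) + l\<^sup>2 * (s1 - t))"
  have \<tau>: "0 < \<tau>" unfolding \<tau>_def using t h by (intro clock_pos) auto
  have E: "0 < E" by (simp add: E_def)
  have dclock: "((\<lambda>t. clock t (s1 - t)) has_real_derivative \<alpha> - 1) (at t)"
    unfolding clock_def by (auto intro!: derivative_eq_intros)
  have dsqrt: "((\<lambda>t. sqrt (clock t (s1 - t))) has_real_derivative inverse (sqrt \<tau>) / 2 * (\<alpha> - 1)) (at t)"
    using DERIV_chain2[OF DERIV_real_sqrt dclock] \<tau> by (simp add: \<tau>_def)
  have d1: "((\<lambda>t. C / sqrt (clock t (s1 - t))) has_real_derivative C * (1 - \<alpha>) / (2 * \<tau> * sqrt \<tau>)) (at t)"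
  proof -
    have "((\<lambda>t. C / sqrt (clock t (s1 - t))) has_real_derivative
      (0 * sqrt (clock t (s1 - t)) - C * (inverse (sqrt \<tau>) / 2 * (\<alpha> - 1))) /
        (sqrt (clock t (s1 - t)) * sqrt (clock t (s1 - t)))) (at t)"
      by (rule DERIV_divide[OF DERIV_const dsqrt]) (use \<tau> in \<open>simp add: \<tau>_def\<close>)
    moreover have "(0 * sqrt (clock t (s1 - t)) - C * (inverse (sqrt \<tau>) / 2 * (\<alpha> - 1))) /
        (sqrt (clock t (s1 - t)) * sqrt (clock t (s1 - t))) = C * (1 - \<alpha>) / (2 * \<tau> * sqrt \<tau>)"
      using \<tau> by (simp add: \<tau>_def[symmetric] field_simps)
    ultimately show ?thesis by simp
  qed
  have d2: "((\<lambda>t. exp (l * (y + c * t) + l\<^sup>2 * (s1 - t))) has_real_derivative E * (p - 1)) (at t)"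
  proof -
    have "((\<lambda>t. l * (y + c * t) + l\<^sup>2 * (s1 - t)) has_real_derivative p - 1) (at t)"
      by (auto intro!: derivative_eq_intros simp: p_f1 f1_def)
    from DERIV_fun_exp[OF this] show ?thesis by (simp add: E_def)
  qed
  have b: "barrier C t (s1 - t) y = C / sqrt \<tau> * E" by (simp add: barrier_def \<tau>_def E_def)
  have "1 / sqrt (\<tau> - \<alpha> * h) \<le> 1 / sqrt \<tau> + 3 * (\<alpha> * h) / (2 * \<tau> * sqrt \<tau>)"
    using \<alpha> h \<tau> t by (intro inverse_sqrt_delay_le) (auto simp: \<tau>_def intro!: clock_ge)
  then have "p * C * E * (1 / sqrt (\<tau> - \<alpha> * h)) \<le> p * C * E * (1 / sqrt \<tau> + 3 * (\<alpha> * h) / (2 * \<tau> * sqrt \<tau>))"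
    using p_nonneg C E by (intro mult_left_mono) auto
  also have "\<dots> = C * E * (p / sqrt \<tau> + 3 * p * (\<alpha> * h) / (2 * \<tau> * sqrt \<tau>))"
    by (simp add: algebra_simps)
  also have "\<dots> = C * (1 - \<alpha>) / (2 * \<tau> * sqrt \<tau>) * E + E * (p - 1) * (C / sqrt \<tau>) + C / sqrt \<tau> * E"
    unfolding \<alpha>(3) by (simp add: algebra_simps diff_divide_distrib)
  finally have "p * (C / sqrt (\<tau> - \<alpha> * h)) * E \<le> \<dots>" by (simp add: mult_ac)
  then show ?thesis
    unfolding b using DERIV_mult[OF d1 d2]
    by (intro exI[of _ "C * (1 - \<alpha>) / (2 * \<tau> * sqrt \<tau>) * E + E * (p - 1) * (C / sqrt \<tau>)"])
       (simp add: barrier_def \<tau>_def[symmetric] E_def[symmetric])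
qed

lemma L1: "L1_continuous_on {- h..} u"
  and nonneg: "- h \<le> t \<Longrightarrow> 0 \<le> u t x"
  and continuous: "0 < t \<Longrightarrow> continuous_on UNIV (u t)"
  and weak: "\<lbrakk>\<And>x. (\<phi> has_real_derivative \<phi>' x) (at x); \<And>x. (\<phi>' has_real_derivative \<phi>'' x) (at x);
       continuous_on UNIV \<phi>''; \<And>x. R < \<bar>x\<bar> \<Longrightarrow> \<phi> x = 0; 0 < t\<rbrakk> \<Longrightarrow>
      ((\<lambda>s. LINT x|lborel. u s x * \<phi> x) has_real_derivative
           (LINT x|lborel. u t x * \<phi>'' x) - (LINT x|lborel. u t x * \<phi> x)
             + (LINT x|lborel. nonlocal_birth g k0 (u (t - h)) x * \<phi> x)) (at t)"
  using sol unfolding solves_ivp_def by blast+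

lemma u_integrable: "- h \<le> t \<Longrightarrow> integrable lborel (u t)"
  using L1_continuous_onD(1)[OF L1, of t] by simp

lemma u_meas: "- h \<le> t \<Longrightarrow> u t \<in> borel_measurable borel"
  using borel_measurable_integrable[OF u_integrable, of t] by simp

text \<open>The comparison on \<open>[0, T]\<close>. The moving test function \<open>q\<close> is the kernel of heat time \<open>s0 + T - t\<close>
times the cutoff, so that its second derivative in \<open>x\<close> and its derivative in \<open>t\<close> add up to terms
containing a derivative of the cutoff. These are at most \<open>\<epsilon> = (30 + 2 * 6) / R * M\<close>. The difference
\<open>F - H\<close> of the truncated heat mean and the barrier then satisfies \<open>(F - H)' \<le> - (F - H) + \<epsilon> U\<close>, and
\<open>F - H - \<epsilon> U\<close> cannot become positive. The maximum in \<open>history\<close> is there because the comparison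
starts at time 0 even if \<open>T < h\<close>.\<close>
lemma truncated_heat_mean_le:
  assumes T: "0 < T" and s0: "0 < s0" and C: "0 \<le> C" and R: "1 \<le> R"
    and U: "\<And>t. t \<in> {0..T} \<Longrightarrow> (LINT x|lborel. \<bar>u t x\<bar>) \<le> U"
    and history: "\<And>t s y. - h \<le> t \<Longrightarrow> t \<le> max 0 (T - h) \<Longrightarrow> 0 < s \<Longrightarrow>
      heat_mean (u t) s y \<le> ennreal (barrier C t s y)"
  shows "(LINT x|lborel. u T x * (bump R (x - y) * heat_kernel s0 (x - y)))
           \<le> barrier C T s0 y + 42 / R * heat_bound s0 * U"
proof -
  define M where "M = heat_bound s0"
  define \<epsilon> where "\<epsilon> = 42 / R * M"
  define s1 where "s1 = s0 + T"
  define q where "q t x = bump R (x - y) * heat_kernel (s1 - t) (x - y)" for t x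
  define F where "F t = (LINT x|lborel. u t x * q t x)" for t
  define H where "H t = barrier C t (s1 - t) y" for t
  have M: "0 \<le> M" using heat_bound_nonneg[OF s0] by (simp add: M_def)
  have R0: "0 < R" using R by simp
  have U0: "0 \<le> U" using U[of 0] T by (smt (verit) Bochner_Integration.integral_nonneg abs_ge_zero atLeastAtMost_iff)
  have \<epsilon>: "0 \<le> \<epsilon>" using R M by (simp add: \<epsilon>_def)
  have G: "\<bar>heat_kernel (s1 - t) x\<bar> \<le> M" "\<bar>heat_kernel_x (s1 - t) x\<bar> \<le> M" "\<bar>heat_kernel_xx (s1 - t) x\<bar> \<le> M"
    if "t \<le> T" for t x
    unfolding M_def using that by (intro heat_kernel_bounds[OF s0]; simp add: s1_def)+
  have bump_meas [measurable]: "bump R \<in> borel_measurable borel"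
    unfolding bump_def[abs_def] by measurable
  have bumpx_meas [measurable]: "bump_x R \<in> borel_measurable borel"
    unfolding bump_x_def[abs_def] by measurable
  have bumpxx_meas [measurable]: "bump_xx R \<in> borel_measurable borel"
    unfolding bump_xx_def[abs_def] by measurable
  have Gx_meas [measurable]: "heat_kernel_x s \<in> borel_measurable borel" for s
    unfolding heat_kernel_x_def[abs_def] by measurable
  have Gxx_meas [measurable]: "heat_kernel_xx s \<in> borel_measurable borel" for s
    unfolding heat_kernel_xx_def[abs_def] by measurable
  have q_meas: "q t \<in> borel_measurable borel" for t
    unfolding q_def[abs_def] by measurable
  have bump_abs: "\<bar>bump R x\<bar> \<le> 1" for x using bump_nonneg bump_le_1 by simp
  have scaled: "\<bar>bump R x * a\<bar> \<le> b" if "\<bar>a\<bar> \<le> b" for x a b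
    using mult_mono[OF bump_abs that, of x] by (simp add: abs_mult)
  have q_bound: "\<bar>q t x\<bar> \<le> M" if "t \<le> T" for t x
    unfolding q_def using G(1)[OF that] by (intro scaled)
  have q_lip: "\<bar>q r x - q t x\<bar> \<le> M * \<bar>r - t\<bar>" if "r \<le> T" "t \<le> T" for r t x
  proof -
    have "\<bar>heat_kernel (s1 - r) (x - y) - heat_kernel (s1 - t) (x - y)\<bar> \<le> M * \<bar>(s1 - r) - (s1 - t)\<bar>"
      unfolding M_def using that by (intro heat_kernel_lipschitz_s[OF s0]) (auto simp: s1_def)
    from scaled[OF this, of "x - y"] show ?thesis
      by (simp add: q_def right_diff_distrib abs_minus_commute)
  qed
  have F_cont: "continuous_on {0..T} F"
    unfolding F_def by (rule L1_continuous_on_pairing[OF L1 _ q_meas q_bound q_lip]) (use h in auto)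
  have source: "(LINT x|lborel. nonlocal_birth g k0 (u (t - h)) x * q t x)
      \<le> p * (C / sqrt (clock t (s1 - t) - \<alpha> * h)) * exp (l * (y + c * t) + l\<^sup>2 * (s1 - t))"
    if t: "0 < t" "t \<le> T" for t
  proof -
    have s: "0 < s1 - t" using t s0 by (simp add: s1_def)
    have "(LINT x|lborel. nonlocal_birth g k0 (u (t - h)) x * q t x) \<le>
      \<gamma> * (C / sqrt (clock (t - h) (s1 - t)) * exp (l * (c * (t - h)) + l\<^sup>2 * (s1 - t))) * exp (l * y) *
       (LINT z|lborel. k0 z * exp (- l * z))"
    proof (rule birth_pairing_le[OF s _ _ g_nonneg g_le \<gamma> k0_nonneg k0_meas k0_exp])
      show "0 \<le> u (t - h) x" for x using t nonneg by simp
      show "u (t - h) \<in> borel_measurable borel" using t by (intro u_meas) auto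
      show "0 \<le> q t x" for x
        unfolding q_def using bump_nonneg heat_kernel_nonneg[OF s] by simp
      show "q t x \<le> heat_kernel (s1 - t) (x - y)" for x
        unfolding q_def using bump_le_1 heat_kernel_nonneg[OF s] by (intro mult_left_le_one_le) (auto simp: bump_nonneg)
      show "heat_mean (u (t - h)) (s1 - t) z \<le>
         ennreal (C / sqrt (clock (t - h) (s1 - t)) * exp (l * (c * (t - h)) + l\<^sup>2 * (s1 - t)) * exp (l * z))" for z
      proof -
        have "heat_mean (u (t - h)) (s1 - t) z \<le> ennreal (barrier C (t - h) (s1 - t) z)"
          using t s by (intro history) auto
        also have "barrier C (t - h) (s1 - t) z =
          C / sqrt (clock (t - h) (s1 - t)) * exp (l * (c * (t - h)) + l\<^sup>2 * (s1 - t)) * exp (l * z)"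
          by (simp add: barrier_def algebra_simps flip: exp_add)
        finally show ?thesis .
      qed
      show "0 \<le> C / sqrt (clock (t - h) (s1 - t)) * exp (l * (c * (t - h)) + l\<^sup>2 * (s1 - t))"
        using C clock_pos[of "t - h" "s1 - t"] t s by simp
    qed
    also have "\<dots> = p * (C / sqrt (clock t (s1 - t) - \<alpha> * h)) * exp (l * (y + c * t) + l\<^sup>2 * (s1 - t))"
      by (rule barrier_delay)
    finally show ?thesis .
  qed
  have F_deriv: "\<exists>D. (F has_real_derivative D) (at t) \<and>
      D \<le> - F t + p * (C / sqrt (clock t (s1 - t) - \<alpha> * h)) * exp (l * (y + c * t) + l\<^sup>2 * (s1 - t)) + \<epsilon> * U"
    if t: "0 < t" "t < T" for t
  proof -
    define s where "s = s1 - t"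
    have s: "0 < s" using t s0 by (simp add: s_def s1_def)
    \<comment> \<open>The derivatives of \<open>q t\<close>: \<open>qx\<close> in \<open>x\<close>, \<open>qs\<close> in time, and \<open>e - qs\<close> twice in \<open>x\<close>; \<open>e\<close> collects what does
      not cancel.\<close>
    define e where "e x = bump_xx R (x - y) * heat_kernel s (x - y)
      + 2 * bump_x R (x - y) * heat_kernel_x s (x - y)" for x
    define qs where "qs x = - bump R (x - y) * heat_kernel_xx s (x - y)" for x
    define qx where "qx x = bump_x R (x - y) * heat_kernel s (x - y) + bump R (x - y) * heat_kernel_x s (x - y)" for x
    have shift: "((\<lambda>x. f (x - y)) has_real_derivative f' (x - y)) (at x)"
      if "\<And>x. (f has_real_derivative f' x) (at x)" for f f' x
    proof -
      have "((\<lambda>x. x - y) has_real_derivative 1) (at x)" by (auto intro!: derivative_eq_intros)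
      from DERIV_chain2[where f = f and g = "\<lambda>x. x - y", OF that this] show ?thesis by simp
    qed
    note d = shift[OF bump_DERIV[OF R0]] shift[OF bump_x_DERIV[OF R0]]
      shift[OF heat_kernel_DERIV_x[OF s]] shift[OF heat_kernel_x_DERIV_x[OF s]]
    have dq: "(q t has_real_derivative qx x) (at x)" for x
      using DERIV_mult[OF d(1) d(3), of x] unfolding q_def[abs_def] qx_def s_def by (simp add: mult.commute)
    have dqx: "(qx has_real_derivative e x - qs x) (at x)" for x
      using DERIV_add[OF DERIV_mult[OF d(2) d(3)] DERIV_mult[OF d(1) d(4)], of x]
      unfolding qx_def[abs_def] e_def qs_def by (simp add: algebra_simps)
    have qxx_cont: "continuous_on UNIV (\<lambda>x. e x - qs x)"
    proof -
      have c: "continuous_on UNIV f" if "\<And>x. (f has_real_derivative f' x) (at x)" for f f' :: "real \<Rightarrow> real"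
        using that by (meson DERIV_isCont continuous_at_imp_continuous_on)
      have "continuous_on UNIV (heat_kernel_xx s)"
        unfolding heat_kernel_xx_def[abs_def]
        by (intro continuous_intros c[OF heat_kernel_DERIV_x[OF s]]) (use s in auto)
      then have xx: "continuous_on UNIV (\<lambda>x. heat_kernel_xx s (x - y))"
        by (rule continuous_on_compose2) (auto intro!: continuous_intros)
      have bxx: "continuous_on UNIV (\<lambda>x. bump_xx R (x - y))"
        by (rule continuous_on_compose2[OF bump_xx_continuous[OF R0]]) (auto intro!: continuous_intros)
      show ?thesis unfolding e_def qs_def
        by (intro continuous_intros xx bxx c[OF d(1)] c[OF d(2)] c[OF d(3)] c[OF d(4)])
    qed
    have supp: "q t x = 0" if "R + \<bar>y\<bar> < \<bar>x\<bar>" for x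
      using that R0 by (simp add: q_def bump_outside)
    define N where "N = (LINT x|lborel. nonlocal_birth g k0 (u (t - h)) x * q t x)"
    have frozen: "((\<lambda>r. LINT x|lborel. u r x * q t x) has_real_derivative
        (LINT x|lborel. u t x * (e x - qs x)) - F t + N) (at t)"
      unfolding F_def N_def by (rule weak[OF dq dqx qxx_cont supp t(1)])
    define \<delta> where "\<delta> = min t (T - t)"
    have \<delta>: "0 < \<delta>" using t by (simp add: \<delta>_def)
    have near: "r \<le> T" if "\<bar>r - t\<bar> < \<delta>" for r using that by (auto simp: \<delta>_def)
    have dqs: "((\<lambda>r. q r x) has_real_derivative qs x) (at t)" for x
    proof -
      have "((\<lambda>r. heat_kernel (s1 - r) (x - y)) has_real_derivative heat_kernel_xx s (x - y) * (- 1)) (at t)"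
        unfolding s_def by (rule DERIV_chain2[OF heat_kernel_DERIV_s])
          (use s in \<open>auto simp: s_def intro!: derivative_eq_intros\<close>)
      from DERIV_cmult[OF this] show ?thesis by (simp add: q_def[abs_def] qs_def)
    qed
    have F': "((\<lambda>r. LINT x|lborel. u r x * q r x) has_real_derivative ((LINT x|lborel. u t x * (e x - qs x)) - F t + N) + (LINT x|lborel. u t x * qs x)) (at t)"
    proof (rule L1_continuous_on_pairing_DERIV[where p = q and p' = qs, OF L1 \<delta>])
      show "{t - \<delta><..<t + \<delta>} \<subseteq> {- h..}" using t h by (auto simp: \<delta>_def)
      show "q r \<in> borel_measurable borel" for r by (rule q_meas)
      show "\<bar>q r x\<bar> \<le> M" if "\<bar>r - t\<bar> < \<delta>" for r x by (rule q_bound[OF near[OF that]])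
      show "\<bar>q r x - q t x\<bar> \<le> M * \<bar>r - t\<bar>" if "\<bar>r - t\<bar> < \<delta>" for r x
        using t by (intro q_lip near[OF that]) auto
      show "((\<lambda>r. q r x) has_real_derivative qs x) (at t)" for x by (rule dqs)
      show "((\<lambda>r. LINT x|lborel. u r x * q t x) has_real_derivative
        (LINT x|lborel. u t x * (e x - qs x)) - F t + N) (at t)" by (rule frozen)
    qed
    have ut: "integrable lborel (u t)" using t h by (intro u_integrable) auto
    have tT: "t \<le> T" using t by simp
    have e_meas: "e \<in> borel_measurable borel" unfolding e_def[abs_def] by measurable
    have qs_meas: "qs \<in> borel_measurable borel" unfolding qs_def[abs_def] by measurable
    have e_le: "\<bar>e x\<bar> \<le> \<epsilon>" for x
    proof -
      have "\<bar>e x\<bar> \<le> \<bar>bump_xx R (x - y)\<bar> * \<bar>heat_kernel s (x - y)\<bar>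
          + 2 * (\<bar>bump_x R (x - y)\<bar> * \<bar>heat_kernel_x s (x - y)\<bar>)"
        unfolding e_def by (rule order_trans[OF abs_triangle_ineq]) (simp add: abs_mult)
      also have "\<dots> \<le> 30 / R * M + 2 * (6 / R * M)"
        unfolding s_def
        using bump_derivative_bounds[OF R, of "x - y"] G[OF tT] R
        by (intro add_mono mult_mono mult_left_mono) auto
      also have "\<dots> = \<epsilon>" by (simp add: \<epsilon>_def field_simps)
      finally show ?thesis .
    qed
    have qs_le: "\<bar>qs x\<bar> \<le> M" for x
      using scaled[OF G(3)[OF tT]] by (simp add: qs_def s_def)
    note e_int = integrable_mult_bounded[OF ut e_meas e_le]
    note qs_int = integrable_mult_bounded[OF ut qs_meas qs_le]
    have "(LINT x|lborel. u t x * (e x - qs x)) = (LINT x|lborel. u t x * e x) - (LINT x|lborel. u t x * qs x)"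
      using e_int(1) qs_int(1) by (simp add: right_diff_distrib)
    moreover have "(LINT x|lborel. u t x * e x) \<le> \<epsilon> * U"
    proof -
      have "(LINT x|lborel. u t x * e x) \<le> \<epsilon> * (LINT x|lborel. \<bar>u t x\<bar>)"
        using e_int(2) by simp
      also have "\<dots> \<le> \<epsilon> * U" using U[of t] t \<epsilon> by (intro mult_left_mono) auto
      finally show ?thesis .
    qed
    moreover have "N \<le> p * (C / sqrt (clock t (s1 - t) - \<alpha> * h)) * exp (l * (y + c * t) + l\<^sup>2 * (s1 - t))"
      unfolding N_def using t by (intro source) auto
    ultimately have "((LINT x|lborel. u t x * (e x - qs x)) - F t + N) + (LINT x|lborel. u t x * qs x)
      \<le> - F t + p * (C / sqrt (clock t (s1 - t) - \<alpha> * h)) * exp (l * (y + c * t) + l\<^sup>2 * (s1 - t)) + \<epsilon> * U"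
      by linarith
    with F'[folded F_def] show ?thesis by blast
  qed
  have H_deriv: "\<exists>D. (H has_real_derivative D) (at t) \<and>
     p * (C / sqrt (clock t (s1 - t) - \<alpha> * h)) * exp (l * (y + c * t) + l\<^sup>2 * (s1 - t)) \<le> D + H t"
    if "0 \<le> t" "t \<le> T" for t
    unfolding H_def[abs_def] using that s0 by (intro barrier_along_characteristic C) (auto simp: s1_def)
  have H_cont: "continuous_on {0..T} H"
    using H_deriv by (meson DERIV_isCont atLeastAtMost_iff continuous_at_imp_continuous_on)
  \<comment> \<open>The factor \<open>exp t\<close> absorbs the damping term \<open>- (F - H - \<epsilon> U)\<close>.\<close>
  define K where "K t = exp t * (F t - H t - \<epsilon> * U)" for t
  have "K T \<le> K 0"
  proof (rule DERIV_nonpos_imp_decreasing_open[where f = K])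
    show "continuous_on {0..T} K" unfolding K_def[abs_def]
      by (intro continuous_intros F_cont H_cont)
    show "\<exists>D. (K has_real_derivative D) (at t) \<and> D \<le> 0" if t: "0 < t" "t < T" for t
    proof -
      obtain D1 where D1: "(F has_real_derivative D1) (at t)"
        "D1 \<le> - F t + p * (C / sqrt (clock t (s1 - t) - \<alpha> * h)) * exp (l * (y + c * t) + l\<^sup>2 * (s1 - t)) + \<epsilon> * U"
        using F_deriv[OF t] by blast
      obtain D2 where D2: "(H has_real_derivative D2) (at t)"
        "p * (C / sqrt (clock t (s1 - t) - \<alpha> * h)) * exp (l * (y + c * t) + l\<^sup>2 * (s1 - t)) \<le> D2 + H t"
        using H_deriv[of t] t by auto
      have "(K has_real_derivative exp t * (F t - H t - \<epsilon> * U) + (D1 - D2 - 0) * exp t) (at t)"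
        unfolding K_def[abs_def]
        by (intro DERIV_mult DERIV_exp DERIV_diff D1(1) D2(1) DERIV_const)
      moreover have "exp t * (F t - H t - \<epsilon> * U) + (D1 - D2 - 0) * exp t = exp t * (F t - H t - \<epsilon> * U + D1 - D2)"
        by (simp add: algebra_simps)
      moreover have "F t - H t - \<epsilon> * U + D1 - D2 \<le> 0" using D1(2) D2(2) by linarith
      ultimately show ?thesis by (metis exp_ge_zero mult_nonneg_nonpos)
    qed
  qed (use T in simp)
  moreover have "K 0 \<le> 0"
  proof -
    have s1: "0 < s1" using s0 T by (simp add: s1_def)
    have "ennreal (F 0) \<le> (\<integral>\<^sup>+x. ennreal (u 0 x * q 0 x) \<partial>lborel)"
      unfolding F_def using nonneg[of 0] h bump_nonneg heat_kernel_nonneg[OF s1]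
      by (intro ennreal_lebesgue_integral_le) (auto simp: q_def)
    also have "\<dots> \<le> heat_mean (u 0) s1 y"
      unfolding heat_mean_def q_def using nonneg[of 0] h bump_le_1 bump_nonneg heat_kernel_nonneg[OF s1]
      by (intro nn_integral_mono ennreal_leI mult_left_mono) (auto intro!: mult_left_le_one_le)
    also have "\<dots> \<le> ennreal (H 0)"
      using history[of 0 s1 y] h s1 by (simp add: H_def)
    finally have "F 0 \<le> H 0"
      using barrier_nonneg[of C 0 s1 y] C h s1 by (simp add: H_def)
    then show ?thesis using mult_nonneg_nonneg[OF \<epsilon> U0] by (simp add: K_def)
  qed
  ultimately have "exp T * (F T - H T - \<epsilon> * U) \<le> 0" by (simp add: K_def)
  then have "F T \<le> H T + \<epsilon> * U" by (simp add: mult_le_0_iff)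
  then show ?thesis by (simp add: F_def H_def q_def s1_def \<epsilon>_def M_def)
qed

text \<open>Removal of the cutoff, \<open>R \<rightarrow> \<infinity>\<close>.\<close>
lemma heat_mean_step:
  assumes T: "0 < T" and s0: "0 < s0" and C: "0 \<le> C"
    and history: "\<And>t s y. - h \<le> t \<Longrightarrow> t \<le> max 0 (T - h) \<Longrightarrow> 0 < s \<Longrightarrow>
      heat_mean (u t) s y \<le> ennreal (barrier C t s y)"
  shows "heat_mean (u T) s0 y \<le> ennreal (barrier C T s0 y)"
proof -
  obtain U where U: "\<And>t. t \<in> {0..T} \<Longrightarrow> (LINT x|lborel. \<bar>u t x\<bar>) \<le> U"
    using L1_continuous_on_norm_bounded[OF L1, of "{0..T}"] h by auto
  define I where "I n x = u T x * (bump (real (Suc n)) (x - y) * heat_kernel s0 (x - y))" for n x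
  have uT: "integrable lborel (u T)" "u T \<in> borel_measurable borel"
    using T h by (auto intro: u_integrable u_meas)
  have uT0: "0 \<le> u T x" for x using T h by (intro nonneg) auto
  have meas [measurable]: "bump r \<in> borel_measurable borel" for r
    unfolding bump_def[abs_def] by measurable
  note [measurable] = uT(2)
  have I_meas: "I n \<in> borel_measurable borel" for n unfolding I_def[abs_def] by measurable
  have I0: "0 \<le> I n x" for n x
    unfolding I_def using uT0 bump_nonneg heat_kernel_nonneg[OF s0] by simp
  have I_int: "integrable lborel (I n)" for n
    unfolding I_def[abs_def]
  proof (rule integrable_mult_bounded(1)[OF uT(1)])
    show "\<bar>bump (real (Suc n)) (x - y) * heat_kernel s0 (x - y)\<bar> \<le> 1 * heat_bound s0" for x
      unfolding abs_mult using heat_kernel_bounds(1)[OF s0 order_refl] bump_nonneg bump_le_1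
      by (intro mult_mono) auto
  qed measurable
  have "heat_mean (u T) s0 y = (\<integral>\<^sup>+x. liminf (\<lambda>n. ennreal (I n x)) \<partial>lborel)"
    unfolding heat_mean_def
  proof (rule nn_integral_cong)
    fix x
    have "(\<lambda>n. I n x) \<longlonglongrightarrow> u T x * (1 * heat_kernel s0 (x - y))"
      unfolding I_def by (intro tendsto_mult tendsto_const bump_tendsto_1)
    then have "(\<lambda>n. ennreal (I n x)) \<longlonglongrightarrow> ennreal (u T x * (1 * heat_kernel s0 (x - y)))"
      by (rule tendsto_ennrealI)
    from lim_imp_Liminf[OF _ this]
    show "ennreal (u T x * heat_kernel s0 (x - y)) = liminf (\<lambda>n. ennreal (I n x))" by simp
  qed
  also have "\<dots> \<le> liminf (\<lambda>n. \<integral>\<^sup>+x. ennreal (I n x) \<partial>lborel)"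
    by (intro nn_integral_liminf) (use I_meas in measurable)
  also have "\<dots> \<le> liminf (\<lambda>n. ennreal (barrier C T s0 y + 42 * heat_bound s0 * U * inverse (real (Suc n))))"
  proof (intro Liminf_mono always_eventually allI)
    fix n
    have "(\<integral>\<^sup>+x. ennreal (I n x) \<partial>lborel) = ennreal (LINT x|lborel. I n x)"
      using I_int I0 by (intro nn_integral_eq_integral) auto
    also have "\<dots> \<le> ennreal (barrier C T s0 y + 42 / real (Suc n) * heat_bound s0 * U)"
      unfolding I_def by (intro ennreal_leI truncated_heat_mean_le T s0 C U history) auto
    finally show "(\<integral>\<^sup>+x. ennreal (I n x) \<partial>lborel)
      \<le> ennreal (barrier C T s0 y + 42 * heat_bound s0 * U * inverse (real (Suc n)))"
      by (simp add: divide_inverse mult_ac)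
  qed
  also have "\<dots> = ennreal (barrier C T s0 y)"
  proof (rule lim_imp_Liminf)
    have "(\<lambda>n. barrier C T s0 y + 42 * heat_bound s0 * U * inverse (real (Suc n)))
        \<longlonglongrightarrow> barrier C T s0 y + 42 * heat_bound s0 * U * 0"
      by (intro tendsto_add tendsto_mult tendsto_const LIMSEQ_inverse_real_of_nat)
    then show "(\<lambda>n. ennreal (barrier C T s0 y + 42 * heat_bound s0 * U * inverse (real (Suc n))))
        \<longlonglongrightarrow> ennreal (barrier C T s0 y)"
      by (auto intro: tendsto_ennrealI)
  qed simp
  finally show ?thesis .
qed

text \<open>Method of steps: the source at time \<open>t\<close> involves \<open>u\<close> at \<open>t - h\<close> only, so the comparison on
\<open>[-h, n h]\<close> implies the one on \<open>[-h, (n + 1) h]\<close>.\<close>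
lemma heat_mean_le_barrier:
  assumes C: "0 \<le> C"
    and init: "\<And>t s y. t \<in> {- h..0} \<Longrightarrow> 0 < s \<Longrightarrow> heat_mean (u t) s y \<le> ennreal (barrier C t s y)"
    and t: "- h \<le> t" and s: "0 < s"
  shows "heat_mean (u t) s y \<le> ennreal (barrier C t s y)"
proof -
  have "\<forall>t s y. - h \<le> t \<longrightarrow> t \<le> real n * h \<longrightarrow> 0 < s \<longrightarrow> heat_mean (u t) s y \<le> ennreal (barrier C t s y)" for n
  proof (induction n)
    case 0
    then show ?case using init by auto
  next
    case (Suc n)
    show ?case
    proof (intro allI impI)
      fix t s y assume t: "- h \<le> t" "t \<le> real (Suc n) * h" and s: "(0::real) < s"
      show "heat_mean (u t) s y \<le> ennreal (barrier C t s y)"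
      proof (cases "t \<le> 0")
        case True
        then show ?thesis using init t s by simp
      next
        case False
        have "max 0 (t - h) \<le> real n * h" using t h by (simp add: algebra_simps)
        then have history: "heat_mean (u r) \<sigma> z \<le> ennreal (barrier C r \<sigma> z)"
          if "- h \<le> r" "r \<le> max 0 (t - h)" "0 < \<sigma>" for r \<sigma> z
          using Suc that by (meson order_trans)
        show ?thesis by (rule heat_mean_step[OF _ s C history]) (use False in auto)
      qed
    qed
  qed
  moreover obtain n where "t \<le> real n * h"
    using reals_Archimedean3[OF h] by (meson less_le)
  ultimately show ?thesis using t s by blast
qed

text \<open>Apart from its exponential factor, which the heat means share, the barrier decays like
\<open>1 / sqrt s\<close> for large \<open>s\<close> and is bounded below by a positive constant for small \<open>s\<close>. The \<open>L\<^sup>1\<close> bound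
in \<open>heat_mean_weighted\<close> is used for \<open>s > 1\<close> and the \<open>L\<^sup>\<infinity>\<close> bound for \<open>s \<le> 1\<close>.\<close>
lemma initial_heat_mean_le_barrier:
  assumes w: "weighted_L1_Linf l h u0"
  obtains C where "0 < C"
    "\<And>t s y. t \<in> {- h..0} \<Longrightarrow> 0 < s \<Longrightarrow> heat_mean (u t) s y \<le> ennreal (barrier C t s y)"
proof -
  obtain K where K: "\<And>t. t \<in> {- h..0} \<Longrightarrow> integrable lborel (\<lambda>x. exp (- l * x) * u0 t x)"
    "\<And>t. t \<in> {- h..0} \<Longrightarrow> (LINT x|lborel. \<bar>exp (- l * x) * u0 t x\<bar>) \<le> K"
    "\<And>t. t \<in> {- h..0} \<Longrightarrow> AE x in lborel. \<bar>exp (- l * x) * u0 t x\<bar> \<le> K"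
    using w unfolding weighted_L1_Linf_def by blast
  have u0: "u t x = u0 t x" if "t \<in> {- h..0}" for t x
    using sol that unfolding solves_ivp_def by blast
  have K0: "0 \<le> K"
    using K(2)[of 0] h by (smt (verit) Bochner_Integration.integral_nonneg abs_ge_zero atLeastAtMost_iff)
  define m where "m = sqrt (1 + 2 * \<alpha> * h)"
  \<comment> \<open>The first factor makes \<open>C\<close> positive, the second handles the clock, and the last one the drift
    \<open>c t\<close> for \<open>t \<in> [-h, 0]\<close>.\<close>
  define C where "C = (K + 1) * m * exp (\<bar>l * c\<bar> * h)"
  have \<alpha>h: "0 < \<alpha> * h" using \<alpha> h by simp
  have m: "0 < m" using \<alpha>h by (simp add: m_def add_pos_pos)
  have "0 < C" using K0 m by (simp add: C_def)
  moreover have "heat_mean (u t) s y \<le> ennreal (barrier C t s y)" if t: "t \<in> {- h..0}" and s: "0 < s" for t s y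
  proof -
    have ut: "u t = u0 t" using u0[OF t] by auto
    have v: "0 \<le> u0 t x" for x using nonneg[of t x] t u0[OF t] by simp
    note hm = heat_mean_weighted[OF s v K(1)[OF t] K(2)[OF t] K(3)[OF t], of y]
    have cl: "0 < clock t s" "clock t s \<le> s + 2 * \<alpha> * h"
      using t s \<alpha> clock_pos[of t s] by (auto simp: clock_def mult_nonneg_nonpos)
    have "heat_mean (u t) s y \<le> ennreal (K * m / sqrt (clock t s) * exp (l * y + l\<^sup>2 * s))"
    proof (cases "s \<le> 1")
      case True
      have "sqrt (clock t s) \<le> m" unfolding m_def using True cl by (intro real_sqrt_le_mono) auto
      then have "1 \<le> m / sqrt (clock t s)" using cl by simp
      then have "K * 1 \<le> K * (m / sqrt (clock t s))" using K0 by (intro mult_left_mono)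
      then have "K * exp (l * y + l\<^sup>2 * s) \<le> K * m / sqrt (clock t s) * exp (l * y + l\<^sup>2 * s)"
        by (intro mult_right_mono) auto
      then show ?thesis unfolding ut using hm(1) by (meson ennreal_leI order_trans)
    next
      case False
      have "clock t s \<le> s + s * (2 * \<alpha> * h)"
        using cl False \<alpha>h mult_right_mono[of 1 s "2 * \<alpha> * h"] by (simp add: mult.assoc)
      also have "\<dots> \<le> 4 * pi * (s + s * (2 * \<alpha> * h))"
      proof -
        have "1 \<le> 4 * pi" using pi_gt3 by simp
        moreover have "0 \<le> s + s * (2 * \<alpha> * h)"
          using s \<alpha> h by (intro add_nonneg_nonneg mult_nonneg_nonneg) auto
        ultimately show ?thesis using mult_right_mono[of 1 "4 * pi"] by simp
      qed
      also have "\<dots> = (4 * pi * s) * (1 + 2 * \<alpha> * h)" by (simp add: algebra_simps)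
      finally have "sqrt (clock t s) \<le> sqrt (4 * pi * s) * m"
        unfolding m_def real_sqrt_mult[symmetric] by (rule real_sqrt_le_mono)
      then have "1 / sqrt (4 * pi * s) \<le> m / sqrt (clock t s)"
        using cl s by (simp add: field_simps)
      then have "K * (1 / sqrt (4 * pi * s)) \<le> K * (m / sqrt (clock t s))" using K0 by (intro mult_left_mono)
      then have "K / sqrt (4 * pi * s) * exp (l * y + l\<^sup>2 * s) \<le> K * m / sqrt (clock t s) * exp (l * y + l\<^sup>2 * s)"
        by (intro mult_right_mono) auto
      then show ?thesis unfolding ut using hm(2) by (meson ennreal_leI order_trans)
    qed
    also have "\<dots> \<le> ennreal (barrier C t s y)"
    proof (rule ennreal_leI)
      have "\<bar>l * c * t\<bar> \<le> \<bar>l * c\<bar> * h"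
        unfolding abs_mult[of "l * c"] using t by (intro mult_left_mono) auto
      then have "0 \<le> \<bar>l * c\<bar> * h + l * c * t" by linarith
      then have "exp (l * y + l\<^sup>2 * s) \<le> exp (\<bar>l * c\<bar> * h + (l * (y + c * t) + l\<^sup>2 * s))"
        by (simp add: algebra_simps)
      then have e: "exp (l * y + l\<^sup>2 * s) \<le> exp (\<bar>l * c\<bar> * h) * exp (l * (y + c * t) + l\<^sup>2 * s)"
        by (simp only: exp_add[of "\<bar>l * c\<bar> * h"])
      have "K * m / sqrt (clock t s) * exp (l * y + l\<^sup>2 * s)
         \<le> (K + 1) * m / sqrt (clock t s) * (exp (\<bar>l * c\<bar> * h) * exp (l * (y + c * t) + l\<^sup>2 * s))"
        using K0 m cl e by (intro mult_mono divide_right_mono mult_right_mono) auto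
      then show "K * m / sqrt (clock t s) * exp (l * y + l\<^sup>2 * s) \<le> barrier C t s y"
        by (simp add: barrier_def C_def mult_ac)
    qed
    finally show ?thesis .
  qed
  ultimately show ?thesis using that by blast
qed

lemma weighted_decay:
  assumes "weighted_L1_Linf l h u0"
  obtains A where "0 < A" "\<And>t x. 0 < t \<Longrightarrow> u t x \<le> A / sqrt t * exp (l * (x + c * t))"
proof -
  obtain C where C: "0 < C"
    "\<And>t s y. t \<in> {- h..0} \<Longrightarrow> 0 < s \<Longrightarrow> heat_mean (u t) s y \<le> ennreal (barrier C t s y)"
    using initial_heat_mean_le_barrier[OF assms] by blast
  show ?thesis
  proof
    show "0 < C / sqrt \<alpha>" using C \<alpha> by simp
    fix t x :: real assume t: "0 < t"
    have cl: "0 < clock t 0" using clock_pos[of t 0] t h by simp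
    have "u t x \<le> barrier C t 0 x"
    proof (rule le_lim_of_heat_mean_le[where v = "u t" and y = x and H = "\<lambda>s. barrier C t s x"])
      show "continuous_on UNIV (u t)" using t by (rule continuous)
      show "0 \<le> u t x" for x using t h by (intro nonneg) auto
      show "heat_mean (u t) s x \<le> ennreal (barrier C t s x)" if "0 < s" for s
        by (rule heat_mean_le_barrier[OF _ C(2)]) (use C(1) t h that in auto)
      have "isCont (\<lambda>s. barrier C t s x) 0"
        unfolding barrier_def clock_def using cl unfolding clock_def by (intro continuous_intros) auto
      then show "((\<lambda>s. barrier C t s x) \<longlongrightarrow> barrier C t 0 x) (at_right 0)"
        unfolding isCont_def by (rule tendsto_within_subset) simp
      show "0 \<le> barrier C t 0 x" using C t h by (intro barrier_nonneg) auto
    qed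
    also have "\<dots> \<le> C / sqrt \<alpha> / sqrt t * exp (l * (x + c * t))"
    proof -
      have "\<alpha> * t \<le> clock t 0" using \<alpha> h by (simp add: clock_def)
      then have "sqrt (\<alpha> * t) \<le> sqrt (clock t 0)" by (rule real_sqrt_le_mono)
      then have "C / sqrt (clock t 0) \<le> C / (sqrt \<alpha> * sqrt t)"
        using C \<alpha> t cl by (intro divide_left_mono) (auto simp: real_sqrt_mult)
      then have "C / sqrt (clock t 0) * exp (l * (x + c * t)) \<le> C / (sqrt \<alpha> * sqrt t) * exp (l * (x + c * t))"
        by (rule mult_right_mono) simp
      then show ?thesis by (simp add: barrier_def)
    qed
    finally show "u t x \<le> C / sqrt \<alpha> / sqrt t * exp (l * (x + c * t))" .
  qed
qed

end

section \<open>Level sets\<close>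

lemma level_set_position:
  assumes A: "0 < A" and \<beta>: "0 < \<beta>" and t: "0 < t"
    and le: "\<beta> \<le> A / sqrt t * exp (l * (x + c * t))"
  shows "ln t / 2 + ln (\<beta> / A) \<le> l * (x + c * t)"
proof -
  have "ln \<beta> \<le> ln (A / sqrt t * exp (l * (x + c * t)))"
    using assms by (subst ln_le_cancel_iff) auto
  also have "\<dots> = ln A - ln t / 2 + l * (x + c * t)"
    using A t by (simp add: ln_mult ln_div ln_sqrt)
  finally show ?thesis using A \<beta> by (simp add: ln_div)
qed

text \<open>Where the level \<open>\<beta>\<close> is not attained, the level-set functions are 0 by convention, and the bound
says that the linear term beats the logarithm.\<close>
lemma ln_le_linear:
  fixes k t :: real
  assumes "0 < k" "0 < t"
  shows "ln t \<le> k * t - (1 + ln k)"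
  using ln_le_minus_one[of "k * t"] assms by (simp add: ln_mult)

theorem theorem3p4:
  fixes h \<kappa> a b cm cp lm lp \<beta> :: real
    and g g' k0 :: "real \<Rightarrow> real"
    and u0 u :: "real \<Rightarrow> real \<Rightarrow> real"
  assumes "0 < h"
    and "monostable g g' \<kappa>"
    and "admissible_kernel k0 a b"
    and "critical_speeds h g k0 cm cp"
    and "- b < lm" "lm < 0" "0 < lp" "lp < - a"
    and "tangent_at (f1 cm) (f2 (g' 0) h k0 cm) lm"
    and "tangent_at (f1 cp) (f2 (g' 0) h k0 cp) lp"
    and "L1_continuous_on {-h..0} u0"
    and "\<forall>s\<in>{-h..0}. \<forall>x. 0 \<le> u0 s x"
    and "solves_ivp h g k0 u0 u"
    and "0 < \<beta>"
  shows "(weighted_L1_Linf lp h u0 \<longrightarrow>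
           (\<exists>B. \<forall>t>0. (\<exists>x. u t x = \<beta>) \<or> 0 < cp \<longrightarrow>
              m_minus u \<beta> t \<ge> ereal (1 / (2 * lp) * ln t - cp * t + B))) \<and>
         (weighted_L1_Linf lm h u0 \<longrightarrow>
           (\<exists>B. \<forall>t>0. (\<exists>x. u t x = \<beta>) \<or> cm < 0 \<longrightarrow>
              m_plus u \<beta> t \<le> ereal (1 / (2 * lm) * ln t - cm * t + B)))"
proof -
  have decay: "\<exists>A>0. \<forall>t>0. \<forall>x. u t x \<le> A / sqrt t * exp (l * (x + c * t))"
    if l: "a < - l" "- l < b" and tan: "tangent_at (f1 c) (f2 (g' 0) h k0 c) l"
      and w: "weighted_L1_Linf l h u0" for l c
  proof -
    interpret linearly_controlled_solution h "g' 0" l c "f1 c l" g k0 u0 u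
    proof
      show "k0 \<in> borel_measurable borel"
        using \<open>admissible_kernel k0 a b\<close>
        by (auto simp: admissible_kernel_def has_bochner_integral_iff dest: borel_measurable_integrable)
      show "integrable lborel (\<lambda>z. k0 z * exp (- l * z))"
        using \<open>admissible_kernel k0 a b\<close> greaterThanLessThan_iff[of "- l" a b] l
        unfolding admissible_kernel_def by blast
    qed (use assms tan in \<open>auto simp: monostable_def admissible_kernel_def tangent_at_def\<close>)
    show ?thesis using weighted_decay[OF w] by metis
  qed
  show ?thesis
  proof (intro conjI impI)
    assume "weighted_L1_Linf lp h u0"
    then obtain A where A: "0 < A" "\<And>t x. 0 < t \<Longrightarrow> u t x \<le> A / sqrt t * exp (lp * (x + cp * t))"
      using decay[of lp cp] assms by (auto simp: admissible_kernel_def)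
    \<comment> \<open>The first entry serves times at which the level is attained, the second one all others; if \<open>cp \<le> 0\<close>
      it is a meaningless but harmless value.\<close>
    define B where "B = min (ln (\<beta> / A) / lp) ((1 + ln (2 * lp * cp)) / (2 * lp))"
    show "\<exists>B. \<forall>t>0. (\<exists>x. u t x = \<beta>) \<or> 0 < cp \<longrightarrow>
              m_minus u \<beta> t \<ge> ereal (1 / (2 * lp) * ln t - cp * t + B)"
    proof (intro exI[of _ B] allI impI)
      fix t :: real assume t: "0 < t" and or: "(\<exists>x. u t x = \<beta>) \<or> 0 < cp"
      show "ereal (1 / (2 * lp) * ln t - cp * t + B) \<le> m_minus u \<beta> t"
      proof (cases "\<exists>x. u t x = \<beta>")
        case True
        have "1 / (2 * lp) * ln t - cp * t + B \<le> x" if x: "u t x = \<beta>" for x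
        proof -
          have "ln t / 2 + ln (\<beta> / A) \<le> lp * (x + cp * t)"
            using A(2)[OF t, of x] x by (intro level_set_position A(1) \<open>0 < \<beta>\<close> t) auto
          then have "(ln t / 2 + ln (\<beta> / A)) / lp \<le> x + cp * t"
            using \<open>0 < lp\<close> by (simp add: pos_divide_le_eq mult.commute)
          moreover have "B \<le> ln (\<beta> / A) / lp" by (simp add: B_def)
          ultimately show ?thesis by (simp add: add_divide_distrib)
        qed
        with True show ?thesis unfolding m_minus_def by (auto intro!: INF_greatest)
      next
        case False
        with or have cp: "0 < cp" by simp
        have "ln t \<le> 2 * lp * cp * t - (1 + ln (2 * lp * cp))"
          using cp \<open>0 < lp\<close> t by (intro ln_le_linear) auto
        then have "ln t / (2 * lp) \<le> (2 * lp * cp * t - (1 + ln (2 * lp * cp))) / (2 * lp)"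
          using \<open>0 < lp\<close> by (intro divide_right_mono) auto
        also have "\<dots> = cp * t - (1 + ln (2 * lp * cp)) / (2 * lp)"
          using \<open>0 < lp\<close> by (simp add: diff_divide_distrib)
        finally have "ln t / (2 * lp) - cp * t + B \<le> 0" by (simp add: B_def)
        then show ?thesis using False by (simp add: m_minus_def)
      qed
    qed
  next
    assume "weighted_L1_Linf lm h u0"
    then obtain A where A: "0 < A" "\<And>t x. 0 < t \<Longrightarrow> u t x \<le> A / sqrt t * exp (lm * (x + cm * t))"
      using decay[of lm cm] assms by (auto simp: admissible_kernel_def)
    \<comment> \<open>The two entries have the same roles; \<open>lm * cm\<close> is positive when the second one is needed.\<close>
    define B where "B = max (ln (\<beta> / A) / lm) ((1 + ln (2 * lm * cm)) / (2 * lm))"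
    show "\<exists>B. \<forall>t>0. (\<exists>x. u t x = \<beta>) \<or> cm < 0 \<longrightarrow>
              m_plus u \<beta> t \<le> ereal (1 / (2 * lm) * ln t - cm * t + B)"
    proof (intro exI[of _ B] allI impI)
      fix t :: real assume t: "0 < t" and or: "(\<exists>x. u t x = \<beta>) \<or> cm < 0"
      show "m_plus u \<beta> t \<le> ereal (1 / (2 * lm) * ln t - cm * t + B)"
      proof (cases "\<exists>x. u t x = \<beta>")
        case True
        have "x \<le> 1 / (2 * lm) * ln t - cm * t + B" if x: "u t x = \<beta>" for x
        proof -
          have "ln t / 2 + ln (\<beta> / A) \<le> lm * (x + cm * t)"
            using A(2)[OF t, of x] x by (intro level_set_position A(1) \<open>0 < \<beta>\<close> t) auto
          then have "x + cm * t \<le> (ln t / 2 + ln (\<beta> / A)) / lm"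
            using \<open>lm < 0\<close> by (simp add: neg_le_divide_eq mult.commute)
          moreover have "ln (\<beta> / A) / lm \<le> B" by (simp add: B_def)
          ultimately show ?thesis by (simp add: add_divide_distrib)
        qed
        with True show ?thesis unfolding m_plus_def by (auto intro!: SUP_least)
      next
        case False
        with or have cm: "cm < 0" by simp
        have pos: "0 < 2 * lm * cm" using cm \<open>lm < 0\<close> by (simp add: mult_neg_neg)
        have "ln t \<le> 2 * lm * cm * t - (1 + ln (2 * lm * cm))"
          using pos t by (rule ln_le_linear)
        then have "(2 * lm * cm * t - (1 + ln (2 * lm * cm))) / (2 * lm) \<le> ln t / (2 * lm)"
          using \<open>lm < 0\<close> by (intro divide_right_mono_neg) auto
        moreover have "(2 * lm * cm * t - (1 + ln (2 * lm * cm))) / (2 * lm)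
            = cm * t - (1 + ln (2 * lm * cm)) / (2 * lm)"
          using \<open>lm < 0\<close> by (simp add: diff_divide_distrib)
        moreover have "(1 + ln (2 * lm * cm)) / (2 * lm) \<le> B" by (simp add: B_def)
        ultimately have "0 \<le> ln t / (2 * lm) - cm * t + B" by linarith
        then show ?thesis using False by (simp add: m_plus_def)
      qed
    qed
  qed
qed

end
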